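(* Assume that the set $\Omega\subset\mathbb{R}^n$ is locally closed at $\bar z\in\Omega$. Then the following statements are equivalent: (i) $\Omega$ is strictly smooth at $\bar z$. (ii) There is some nonnegative integer $d$ such that $\Omega$ is a Lipschitz manifold of dimension $d$ around $\bar z$ and $\widehat T_\Omega(\bar z)$ is a $d$-dimensional subspace. (iii) $\Omega$ is a Lipschitz manifold around $\bar z$ and $T^P_\Omega(\bar z)$ is a subspace. (iv) $\Omega$ is a Lipschitz manifold around $\bar z$ and $N_\Omega(\bar z)$ is a subspace. (v) $\Omega$ is a Lipschitz manifold around $\bar z$ and $\Omega$ is normally regular at $\bar z$. In every case there holds $\dim T^P_\Omega(\bar z)=\dim T_\Omega(\bar z)=\dim\widehat T_\Omega(\bar z)=d$ and $\dim N_\Omega(\bar z)=n-d$, where $d$ is the dimension of the Lipschitz manifold $\Omega$ (around $\bar z$).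
   Context: Set limits are in the Painlevé–Kuratowski sense: for a family $C_t$ of sets, $\limsup_{t\to\bar t}C_t=\{x\mid\liminf_{t\to\bar t}\mathrm{dist}(x,C_t)=0\}$ and $\liminf_{t\to\bar t}C_t=\{x\mid\limsup_{t\to\bar t}\mathrm{dist}(x,C_t)=0\}$; the limit exists if both coincide. The polar cone of $A\subset\mathbb{R}^n$ is $A^\circ=\{v\mid\langle v,a\rangle\le0\ \forall a\in A\}$. For $\Omega\subset\mathbb{R}^n$ and $\bar z\in\Omega$: - tangent cone: $T_\Omega(\bar z)=\limsup_{t\downarrow0}\frac{\Omega-\bar z}{t}$; - regular (Clarke) tangent cone: $\widehat T_\Omega(\bar z)=\liminf_{z\to\bar z,\,z\in\Omega,\,t\downarrow0}\frac{\Omega-z}{t}$; - paratingent cone: $T^P_\Omega(\bar z)=\limsup_{z\to\bar z,\,z\in\Omega,\,t\downarrow0}\frac{\Omega-z}{t}$; - regular normal cone: $\widehat N_\Omega(\bar z)=(T_\Omega(\bar z))^\circ$; - limiting normal cone: $N_\Omega(\bar z)=\limsup_{z\to\bar z,\,z\in\Omega}\widehat N_\Omega(z)$. $\Omega$ is strictly smooth at $\bar z$ if $\lim_{z\to\bar z,\,z\in\Omega,\,t\downarrow0}\frac{\Omega-z}{t}$ exists, i.e. $\widehat T_\Omega(\bar z)=T^P_\Omega(\bar z)$. $\Omega$ is normally regular at $\bar z$ if $\widehat N_\Omega(\bar z)=N_\Omega(\bar z)$. $\Omega$ is a Lipschitz manifold of dimension $d$ around $\bar z\in\Omega$ ($0\le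 d\le n$, $\mathbb{R}^0=\{0\}$) if there is an open neighborhood $W$ of $\bar z$ and a one-to-one mapping $\Phi$ from $W$ onto an open subset of $\mathbb{R}^n$, with $\Phi$ and $\Phi^{-1}$ continuously differentiable, such that $\Phi(\Omega\cap W)$ is the graph of a Lipschitz continuous mapping $f:U\to\mathbb{R}^{n-d}$, where $U$ is an open set in $\mathbb{R}^d$. "Lipschitz manifold around $\bar z$" without a dimension means of some dimension $d$. *)

theory Defs
  imports "HOL-Analysis.Analysis"
begin

text \<open>Distance with the convention that the empty set is infinitely far away; the library's
  \<open>infdist\<close> has the value 0 there instead.\<close>

definition set_distance :: "'a::metric_space \<Rightarrow> 'a set \<Rightarrow> ereal" where
  "set_distance x C = (INF y\<in>C. ereal (dist x y))"

text \<open>Painleve--Kuratowski set limits of a family \<open>C\<close> along a filter \<open>F\<close> on its parameters.\<close>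

definition set_Limsup :: "'t filter \<Rightarrow> ('t \<Rightarrow> 'a::metric_space set) \<Rightarrow> 'a set" where
  "set_Limsup F C = {x. Liminf F (\<lambda>t. set_distance x (C t)) = 0}"

definition set_Liminf :: "'t filter \<Rightarrow> ('t \<Rightarrow> 'a::metric_space set) \<Rightarrow> 'a set" where
  "set_Liminf F C = {x. Limsup F (\<lambda>t. set_distance x (C t)) = 0}"

definition set_Lim_exists :: "'t filter \<Rightarrow> ('t \<Rightarrow> 'a::metric_space set) \<Rightarrow> bool" where
  "set_Lim_exists F C \<longleftrightarrow> set_Liminf F C = set_Limsup F C"

text \<open>The filter of \<open>z \<rightarrow> zb\<close> with \<open>z \<in> \<Omega>\<close>. Unlike \<open>at zb within \<Omega>\<close> it does not exclude
  \<open>z = zb\<close>.\<close>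

definition nhds_in :: "'a::topological_space set \<Rightarrow> 'a \<Rightarrow> 'a filter" where
  "nhds_in \<Omega> zb = inf (nhds zb) (principal \<Omega>)"

definition diff_quotient_set :: "'a::real_normed_vector set \<Rightarrow> 'a \<Rightarrow> real \<Rightarrow> 'a set" where
  "diff_quotient_set \<Omega> z t = (\<lambda>w. (w - z) /\<^sub>R t) ` \<Omega>"

definition tangent_cone :: "'a::real_normed_vector set \<Rightarrow> 'a \<Rightarrow> 'a set" where
  "tangent_cone \<Omega> zb = set_Limsup (at_right 0) (diff_quotient_set \<Omega> zb)"

definition regular_tangent_cone :: "'a::real_normed_vector set \<Rightarrow> 'a \<Rightarrow> 'a set" where
  "regular_tangent_cone \<Omega> zb =
     set_Liminf (nhds_in \<Omega> zb \<times>\<^sub>F at_right 0) (\<lambda>(z, t). diff_quotient_set \<Omega> z t)"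

definition paratingent_cone :: "'a::real_normed_vector set \<Rightarrow> 'a \<Rightarrow> 'a set" where
  "paratingent_cone \<Omega> zb =
     set_Limsup (nhds_in \<Omega> zb \<times>\<^sub>F at_right 0) (\<lambda>(z, t). diff_quotient_set \<Omega> z t)"

definition polar_cone :: "'a::real_inner set \<Rightarrow> 'a set" where
  "polar_cone A = {v. \<forall>a\<in>A. v \<bullet> a \<le> 0}"

definition regular_normal_cone :: "'a::real_inner set \<Rightarrow> 'a \<Rightarrow> 'a set" where
  "regular_normal_cone \<Omega> zb = polar_cone (tangent_cone \<Omega> zb)"

definition limiting_normal_cone :: "'a::real_inner set \<Rightarrow> 'a \<Rightarrow> 'a set" where
  "limiting_normal_cone \<Omega> zb = set_Limsup (nhds_in \<Omega> zb) (regular_normal_cone \<Omega>)"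

definition strictly_smooth :: "'a::real_normed_vector set \<Rightarrow> 'a \<Rightarrow> bool" where
  "strictly_smooth \<Omega> zb \<longleftrightarrow>
     set_Lim_exists (nhds_in \<Omega> zb \<times>\<^sub>F at_right 0) (\<lambda>(z, t). diff_quotient_set \<Omega> z t)"

definition normally_regular :: "'a::real_inner set \<Rightarrow> 'a \<Rightarrow> bool" where
  "normally_regular \<Omega> zb \<longleftrightarrow> regular_normal_cone \<Omega> zb = limiting_normal_cone \<Omega> zb"

definition locally_closed_at :: "'a::topological_space set \<Rightarrow> 'a \<Rightarrow> bool" where
  "locally_closed_at \<Omega> zb \<longleftrightarrow> (\<exists>V. closed V \<and> zb \<in> interior V \<and> closed (\<Omega> \<inter> V))"

definition continuously_differentiable_on ::
  "('a::real_normed_vector \<Rightarrow> 'b::real_normed_vector) \<Rightarrow> 'a set \<Rightarrow> bool" where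
  "continuously_differentiable_on g S \<longleftrightarrow>
     (\<exists>g' :: 'a \<Rightarrow> 'a \<Rightarrow>\<^sub>L 'b. continuous_on S g' \<and>
        (\<forall>x\<in>S. (g has_derivative blinfun_apply (g' x)) (at x)))"

text \<open>The copy of \<open>\<real>\<^sup>d\<close> in \<open>\<real>\<^sup>n\<close> formed by the coordinates in \<open>K\<close>, where \<open>d = card K\<close>.\<close>

definition coord_space :: "'n::finite set \<Rightarrow> (real ^ 'n) set" where
  "coord_space K = {x. \<forall>i. i \<notin> K \<longrightarrow> x $ i = 0}"

text \<open>The decomposition \<open>\<real>\<^sup>n = \<real>\<^sup>d \<times> \<real>\<^sup>n\<^sup>-\<^sup>d\<close> is rendered by a set \<open>K\<close> of \<open>d\<close> coordinates and its
  complement, so that the pair \<open>(u, f u)\<close> becomes the vector \<open>u + f u\<close>. The choice of \<open>K\<close> is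
  immaterial, since a coordinate permutation can be absorbed into \<open>\<Phi>\<close>.\<close>

definition lipschitz_manifold_dim :: "nat \<Rightarrow> (real ^ 'n::finite) set \<Rightarrow> real ^ 'n \<Rightarrow> bool" where
  "lipschitz_manifold_dim d \<Omega> zb \<longleftrightarrow>
     (\<exists>W (\<Phi> :: real ^ 'n \<Rightarrow> real ^ 'n) (K :: 'n set) U f L.
        open W \<and> zb \<in> W \<and>
        inj_on \<Phi> W \<and> open (\<Phi> ` W) \<and>
        continuously_differentiable_on \<Phi> W \<and>
        continuously_differentiable_on (inv_into W \<Phi>) (\<Phi> ` W) \<and>
        card K = d \<and>
        openin (top_of_set (coord_space K)) U \<and>
        f ` U \<subseteq> coord_space (- K) \<and>
        L-lipschitz_on U f \<and>
        \<Phi> ` (\<Omega> \<inter> W) = (\<lambda>u. u + f u) ` U)"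

definition lipschitz_manifold :: "(real ^ 'n::finite) set \<Rightarrow> real ^ 'n \<Rightarrow> bool" where
  "lipschitz_manifold \<Omega> zb \<longleftrightarrow> (\<exists>d. lipschitz_manifold_dim d \<Omega> zb)"

end

theory Submission
  imports Defs
begin

text \<open>A set is strictly smooth at \<open>zb\<close> if the largest and the smallest limit of its difference
  quotients, the paratingent cone \<open>T\<^sup>P\<close> and the regular tangent cone \<open>T\<^sup>r\<close>, coincide. Since \<open>T\<^sup>r\<close> is
  convex and \<open>T\<^sup>P\<close> is symmetric, the common value \<open>V\<close> is a subspace.

  \<^emph>\<open>Strict smoothness implies the other properties.\<close> Choose a coordinate projection \<open>P\<close> that is
  injective on \<open>V\<close>. Because directions between nearby points of the set are nearly in \<open>T\<^sup>P = V\<close>, the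
  map \<open>P\<close> is locally expansive on the set, which is thus a Lipschitz graph over its image
  (\<open>expansive_if_injective_on_paratingent_cone\<close>). Because one can move from all nearby points in all
  directions of \<open>T\<^sup>r = V\<close>, a point of the set whose image is closest to a given target must reach
  it, so the image is open (\<open>projection_covers_neighborhood\<close>). Hence the set is a Lipschitz manifold.
  Both normal cones lie between the polar of \<open>T\<^sup>r\<close> and that of the tangent cone, and so equal the
  orthogonal complement of \<open>V\<close>.

  \<^emph>\<open>Converse.\<close> For a Lipschitz manifold, let \<open>B\<close> be the derivative of the chart at \<open>zb\<close> followed by the
  projection onto the parameter space (\<open>lipschitz_manifold_imp_linear_chart\<close>). Then \<open>B\<close> controls the
  norm on \<open>T\<^sup>P\<close> and maps the tangent cone onto \<open>range B\<close>. Therefore any subspace inside \<open>T\<^sup>P\<close>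
  has dimension at most \<open>d = dim (range B)\<close>, and strict smoothness follows as soon as \<open>T\<^sup>r\<close> is also
  mapped onto \<open>range B\<close> (\<open>strictly_smooth_if_image_regular_tangent\<close>). If \<open>T\<^sup>r\<close> is a \<open>d\<close>-dimensional
  subspace, this is a count of dimensions. If \<open>T\<^sup>P\<close> is a subspace, every direction of \<open>range B\<close> has
  a unique paratingent above it, so all difference quotients above this direction converge.

  The conditions on normals use the duality \<open>N\<^sup>\<circ> \<subseteq> T\<^sup>r\<close> for the limiting normal cone \<open>N\<close> of a locally
  closed set (\<open>polar_limiting_normal_subset_regular_tangent_cone\<close>): if \<open>z + t v\<close> is far from the
  set, then the distance function grows somewhere along the segment, and a nearest point provides a
  normal that makes an acute angle with \<open>v\<close>. Normal regularity then yields \<open>T \<subseteq> T\<^sup>r\<close> for the tangent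
  cone \<open>T\<close>. If \<open>N\<close> is a subspace, then \<open>T\<^sup>r\<close> is its orthogonal complement; \<open>N\<close> meets the
  \<open>d\<close>-dimensional image of \<open>range B\<close> under the adjoint of \<open>B\<close> only in \<open>0\<close>, so \<open>T\<^sup>r\<close> has
  dimension at least \<open>d\<close> and the previous criterion applies.\<close>

section \<open>Painleve--Kuratowski limits of sets\<close>

lemma set_distance_nonneg: "0 \<le> set_distance x C"
  unfolding set_distance_def by (intro INF_greatest) simp

lemma set_distance_less_iff: "set_distance x C < ereal e \<longleftrightarrow> (\<exists>y\<in>C. dist x y < e)"
  unfolding set_distance_def by (simp add: INF_less_iff)

lemma mem_set_Limsup_iff:
  "x \<in> set_Limsup F C \<longleftrightarrow> (\<forall>e>0. \<exists>\<^sub>F t in F. \<exists>y\<in>C t. dist x y < e)"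
proof -
  let ?g = "\<lambda>t. set_distance x (C t)"
  have nn: "0 \<le> Liminf F ?g"
    by (rule Liminf_bounded) (simp add: set_distance_nonneg)
  have "x \<in> set_Limsup F C \<longleftrightarrow> Liminf F ?g \<le> 0"
    using nn by (auto simp: set_Limsup_def)
  also have "\<dots> \<longleftrightarrow> (\<forall>e>0. \<not> ereal e \<le> Liminf F ?g)"
  proof
    assume "Liminf F ?g \<le> 0"
    then show "\<forall>e>0. \<not> ereal e \<le> Liminf F ?g"
      by (meson ereal_less(2) leD order.trans)
  next
    assume a: "\<forall>e>0. \<not> ereal e \<le> Liminf F ?g"
    show "Liminf F ?g \<le> 0"
      by (rule ereal_le_epsilon2) (use a in \<open>auto simp: not_le intro: less_imp_le\<close>)
  qed
  also have "\<dots> \<longleftrightarrow> (\<forall>e>0. \<exists>\<^sub>F t in F. ?g t < ereal e)"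
  proof
    assume a: "\<forall>e>0. \<not> ereal e \<le> Liminf F ?g"
    show "\<forall>e>0. \<exists>\<^sub>F t in F. ?g t < ereal e"
    proof (intro allI impI)
      fix e :: real assume "e > 0"
      show "\<exists>\<^sub>F t in F. ?g t < ereal e"
      proof (rule ccontr)
        assume "\<not> ?thesis"
        then have "\<forall>\<^sub>F t in F. ereal e \<le> ?g t" by (simp add: not_frequently not_less)
        then have "ereal e \<le> Liminf F ?g" by (rule Liminf_bounded)
        with a \<open>e > 0\<close> show False by blast
      qed
    qed
  next
    assume a: "\<forall>e>0. \<exists>\<^sub>F t in F. ?g t < ereal e"
    show "\<forall>e>0. \<not> ereal e \<le> Liminf F ?g"
    proof (intro allI impI notI)
      fix e :: real assume e: "e > 0" and le: "ereal e \<le> Liminf F ?g"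
      have "\<forall>\<^sub>F t in F. ereal (e/2) < ?g t"
        using le e unfolding le_Liminf_iff by simp
      moreover have "\<exists>\<^sub>F t in F. ?g t < ereal (e/2)" using a e by simp
      ultimately have "\<exists>\<^sub>F t in F. ?g t < ereal (e/2) \<and> ereal (e/2) < ?g t"
        by (simp add: frequently_eventually_frequently)
      then show False by (auto dest: frequently_ex)
    qed
  qed
  finally show ?thesis by (simp add: set_distance_less_iff)
qed

lemma mem_set_Liminf_iff:
  assumes "F \<noteq> bot"
  shows "x \<in> set_Liminf F C \<longleftrightarrow> (\<forall>e>0. \<forall>\<^sub>F t in F. \<exists>y\<in>C t. dist x y < e)"
proof -
  let ?g = "\<lambda>t. set_distance x (C t)"
  have "0 \<le> Liminf F ?g"
    by (rule Liminf_bounded) (simp add: set_distance_nonneg)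
  then have nn: "0 \<le> Limsup F ?g"
    using Liminf_le_Limsup[OF assms, of ?g] by order
  have "x \<in> set_Liminf F C \<longleftrightarrow> Limsup F ?g \<le> 0"
    using nn by (auto simp: set_Liminf_def)
  also have "\<dots> \<longleftrightarrow> (\<forall>y>0. \<forall>\<^sub>F t in F. ?g t < y)"
    by (simp add: Limsup_le_iff)
  also have "\<dots> \<longleftrightarrow> (\<forall>e>0. \<forall>\<^sub>F t in F. ?g t < ereal e)"
  proof
    assume "\<forall>y>0. \<forall>\<^sub>F t in F. ?g t < y"
    then show "\<forall>e>0. \<forall>\<^sub>F t in F. ?g t < ereal e" by simp
  next
    assume a: "\<forall>e>0. \<forall>\<^sub>F t in F. ?g t < ereal e"
    show "\<forall>y>0. \<forall>\<^sub>F t in F. ?g t < y"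
    proof (intro allI impI)
      fix y :: ereal assume "y > 0"
      then obtain e where e: "0 < ereal e" "ereal e < y"
        using ereal_dense2 by blast
      then have "\<forall>\<^sub>F t in F. ?g t < ereal e" using a by simp
      then show "\<forall>\<^sub>F t in F. ?g t < y"
        by (rule eventually_mono) (use e in order)
    qed
  qed
  finally show ?thesis by (simp add: set_distance_less_iff)
qed

lemma closed_set_Limsup: "closed (set_Limsup F C)"
proof -
  have "x \<in> set_Limsup F C" if x: "x \<in> closure (set_Limsup F C)" for x
    unfolding mem_set_Limsup_iff
  proof (intro allI impI)
    fix e :: real assume "e > 0"
    then obtain y where y: "y \<in> set_Limsup F C" "dist y x < e/2"
      using x unfolding closure_approachable by (meson half_gt_zero)
    then have "\<exists>\<^sub>F t in F. \<exists>u\<in>C t. dist y u < e/2"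
      using half_gt_zero[OF \<open>e > 0\<close>] unfolding mem_set_Limsup_iff by blast
    then show "\<exists>\<^sub>F t in F. \<exists>u\<in>C t. dist x u < e"
      by (rule frequently_elim1) (metis y(2) dist_commute dist_triangle_half_l)
  qed
  then show ?thesis
    by (metis closure_subset_eq subsetI)
qed

text \<open>If no point of the compact set were in the outer limit, every point would have a ball that
  the sets \<open>C t\<close> eventually avoid; finitely many of these balls cover the compact set. All limits
  of difference quotients and of normals below are extracted with this lemma, so that no
  subsequences appear.\<close>

lemma set_Limsup_meets_compact:
  assumes "compact S" and meets: "\<exists>\<^sub>F t in F. C t \<inter> S \<noteq> {}"
  shows "set_Limsup F C \<inter> S \<noteq> {}"
proof (rule ccontr)
  assume contra: "\<not> ?thesis"
  have "\<exists>e>0. \<forall>\<^sub>F t in F. \<forall>y\<in>C t. e \<le> dist x y" if "x \<in> S" for x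
  proof -
    from that contra have "x \<notin> set_Limsup F C" by blast
    then show ?thesis by (auto simp: mem_set_Limsup_iff not_frequently not_less)
  qed
  then obtain e where e: "\<And>x. x \<in> S \<Longrightarrow> 0 < e x"
    "\<And>x. x \<in> S \<Longrightarrow> \<forall>\<^sub>F t in F. \<forall>y\<in>C t. e x \<le> dist x y" by metis
  have "S \<subseteq> (\<Union>x\<in>S. ball x (e x))" using e(1) by force
  then obtain D where D: "D \<subseteq> S" "finite D" "S \<subseteq> (\<Union>x\<in>D. ball x (e x))"
    using compactE_image[OF \<open>compact S\<close>, of S "\<lambda>x. ball x (e x)"] by auto
  have "\<forall>\<^sub>F t in F. \<forall>x\<in>D. \<forall>y\<in>C t. e x \<le> dist x y"
    by (rule eventually_ball_finite) (use D e in auto)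
  then have "\<forall>\<^sub>F t in F. C t \<inter> S = {}"
  proof (rule eventually_mono)
    fix t assume *: "\<forall>x\<in>D. \<forall>y\<in>C t. e x \<le> dist x y"
    have False if y: "y \<in> C t" "y \<in> S" for y
    proof -
      obtain x where "x \<in> D" "dist x y < e x" using D(3) y(2) by auto
      with * y(1) show False by fastforce
    qed
    then show "C t \<inter> S = {}" by blast
  qed
  with meets show False by (simp add: frequently_def)
qed

text \<open>A finite net of the compact set suffices, since membership in the inner limit is stable
  under small perturbations. This turns the pointwise definition of the regular tangent cone into a
  statement uniform in the direction.\<close>

lemma set_Liminf_uniform_on_compact:
  assumes "F \<noteq> bot" "compact S" "S \<subseteq> set_Liminf F C" "e > 0"
  shows "\<forall>\<^sub>F t in F. \<forall>x\<in>S. \<exists>y\<in>C t. dist x y < e"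
proof -
  have "S \<subseteq> (\<Union>x\<in>S. ball x (e/2))" using \<open>e > 0\<close> by force
  then obtain D where D: "D \<subseteq> S" "finite D" "S \<subseteq> (\<Union>x\<in>D. ball x (e/2))"
    using compactE_image[OF \<open>compact S\<close>, of S "\<lambda>x. ball x (e/2)"] by auto
  have "\<forall>\<^sub>F t in F. \<forall>x\<in>D. \<exists>y\<in>C t. dist x y < e/2"
  proof (rule eventually_ball_finite)
    show "\<forall>x\<in>D. \<forall>\<^sub>F t in F. \<exists>y\<in>C t. dist x y < e/2"
      using D(1) assms half_gt_zero[OF \<open>e > 0\<close>] mem_set_Liminf_iff[OF \<open>F \<noteq> bot\<close>] by blast
  qed (fact D(2))
  then show ?thesis
  proof (rule eventually_mono)
    fix t assume *: "\<forall>x\<in>D. \<exists>y\<in>C t. dist x y < e/2"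
    show "\<forall>x\<in>S. \<exists>y\<in>C t. dist x y < e"
    proof
      fix x assume "x \<in> S"
      then obtain c where c: "c \<in> D" "dist c x < e/2" using D(3) by auto
      with * obtain y where "y \<in> C t" "dist c y < e/2" by blast
      then show "\<exists>y\<in>C t. dist x y < e"
        using dist_triangle_half_r[of c x e y] c(2) by blast
    qed
  qed
qed

section \<open>Metric descriptions of the tangent and normal cones\<close>

lemma eventually_nhds_in:
  "(\<forall>\<^sub>F z in nhds_in \<Omega> zb. P z) \<longleftrightarrow> (\<exists>d>0. \<forall>z\<in>\<Omega>. dist z zb < d \<longrightarrow> P z)"
  unfolding nhds_in_def eventually_inf_principal eventually_nhds_metric by blast

lemma frequently_nhds_in:
  "(\<exists>\<^sub>F z in nhds_in \<Omega> zb. P z) \<longleftrightarrow> (\<forall>d>0. \<exists>z\<in>\<Omega>. dist z zb < d \<and> P z)"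
  unfolding frequently_def eventually_nhds_in by blast

lemma eventually_at_right_0:
  "(\<forall>\<^sub>F t in at_right (0::real). P t) \<longleftrightarrow> (\<exists>d>0. \<forall>t. 0 < t \<longrightarrow> t < d \<longrightarrow> P t)"
  unfolding eventually_at_right_field by auto

lemma frequently_at_right_0:
  "(\<exists>\<^sub>F t in at_right (0::real). P t) \<longleftrightarrow> (\<forall>d>0. \<exists>t. 0 < t \<and> t < d \<and> P t)"
  unfolding frequently_def eventually_at_right_0 by blast

lemma eventually_base_point_scale:
  "(\<forall>\<^sub>F p in nhds_in \<Omega> zb \<times>\<^sub>F at_right (0::real). P p) \<longleftrightarrow>
   (\<exists>d>0. \<forall>z\<in>\<Omega>. \<forall>t. dist z zb < d \<longrightarrow> 0 < t \<longrightarrow> t < d \<longrightarrow> P (z, t))"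
proof
  assume "\<forall>\<^sub>F p in nhds_in \<Omega> zb \<times>\<^sub>F at_right 0. P p"
  then obtain Q R where QR: "eventually Q (nhds_in \<Omega> zb)" "eventually R (at_right (0::real))"
    "\<forall>x y. Q x \<longrightarrow> R y \<longrightarrow> P (x, y)"
    by (auto simp: eventually_prod_filter)
  then obtain c d where "c > 0" "d > 0" "\<forall>z\<in>\<Omega>. dist z zb < c \<longrightarrow> Q z" "\<forall>t. 0 < t \<longrightarrow> t < d \<longrightarrow> R t"
    by (auto simp: eventually_nhds_in eventually_at_right_0)
  with QR(3) show "\<exists>d>0. \<forall>z\<in>\<Omega>. \<forall>t. dist z zb < d \<longrightarrow> 0 < t \<longrightarrow> t < d \<longrightarrow> P (z, t)"
    by (intro exI[of _ "min c d"]) auto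
next
  assume "\<exists>d>0. \<forall>z\<in>\<Omega>. \<forall>t. dist z zb < d \<longrightarrow> 0 < t \<longrightarrow> t < d \<longrightarrow> P (z, t)"
  then obtain d where d: "d > 0"
    "\<forall>z\<in>\<Omega>. \<forall>t. dist z zb < d \<longrightarrow> 0 < t \<longrightarrow> t < d \<longrightarrow> P (z, t)" by blast
  show "\<forall>\<^sub>F p in nhds_in \<Omega> zb \<times>\<^sub>F at_right 0. P p"
    unfolding eventually_prod_filter
    by (rule exI[of _ "\<lambda>z. z \<in> \<Omega> \<and> dist z zb < d"], rule exI[of _ "\<lambda>t. 0 < t \<and> t < d"])
      (use d in \<open>auto simp: eventually_nhds_in eventually_at_right_0\<close>)
qed

lemma frequently_base_point_scale:
  "(\<exists>\<^sub>F p in nhds_in \<Omega> zb \<times>\<^sub>F at_right (0::real). P p) \<longleftrightarrow>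
   (\<forall>d>0. \<exists>z\<in>\<Omega>. \<exists>t. dist z zb < d \<and> 0 < t \<and> t < d \<and> P (z, t))"
  unfolding frequently_def eventually_base_point_scale by blast

lemma base_point_scale_nontrivial:
  fixes zb :: "'a::metric_space"
  assumes "zb \<in> \<Omega>"
  shows "nhds_in \<Omega> zb \<times>\<^sub>F at_right (0::real) \<noteq> bot"
proof -
  have "\<exists>\<^sub>F p in nhds_in \<Omega> zb \<times>\<^sub>F at_right (0::real). True"
    unfolding frequently_base_point_scale using assms
    by (auto intro!: bexI[of _ zb] dense)
  then show ?thesis by (auto simp: frequently_def)
qed

lemma dist_diff_quotient:
  assumes "t > 0"
  shows "dist v ((w - z) /\<^sub>R t) < e \<longleftrightarrow> norm (w - z - t *\<^sub>R v) < e * t"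
proof -
  have "w - z - t *\<^sub>R v = t *\<^sub>R ((w - z) /\<^sub>R t - v)"
    using assms by (simp add: algebra_simps)
  then have "norm (w - z - t *\<^sub>R v) = t * dist v ((w - z) /\<^sub>R t)"
    using assms by (simp add: dist_norm norm_minus_commute del: scaleR_diff_right)
  then show ?thesis using assms by (simp add: mult.commute)
qed

text \<open>One tolerance \<open>e\<close> bounds both the scale and the error, and the error is multiplied by the
  scale to avoid difference quotients. The paratingent cone is described in the same way, with
  \<open>e\<close> bounding also the distance of the base point from \<open>zb\<close>.\<close>

lemma mem_tangent_cone_iff:
  "v \<in> tangent_cone \<Omega> z \<longleftrightarrow>
   (\<forall>e>0. \<exists>w\<in>\<Omega>. \<exists>t. 0 < t \<and> t < e \<and> norm (w - z - t *\<^sub>R v) < e * t)" (is "?L \<longleftrightarrow> ?R")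
proof -
  have "?L \<longleftrightarrow> (\<forall>e>0. \<forall>d>0. \<exists>t. 0 < t \<and> t < d \<and> (\<exists>w\<in>\<Omega>. norm (w - z - t *\<^sub>R v) < e * t))"
    unfolding tangent_cone_def mem_set_Limsup_iff frequently_at_right_0 diff_quotient_set_def
    by (simp add: dist_diff_quotient cong: conj_cong)
  also have "\<dots> \<longleftrightarrow> ?R"
  proof
    assume R: ?R
    show "\<forall>e>0. \<forall>d>0. \<exists>t. 0 < t \<and> t < d \<and> (\<exists>w\<in>\<Omega>. norm (w - z - t *\<^sub>R v) < e * t)"
    proof (intro allI impI)
      fix e d :: real assume "e > 0" "d > 0"
      then obtain w t where wt: "w \<in> \<Omega>" "0 < t" "t < min e d" "norm (w - z - t *\<^sub>R v) < min e d * t"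
        using R[rule_format, of "min e d"] by auto
      moreover have "min e d * t \<le> e * t" using wt(2) by (intro mult_right_mono) auto
      ultimately have "t < d" "norm (w - z - t *\<^sub>R v) < e * t" by linarith+
      with wt show "\<exists>t. 0 < t \<and> t < d \<and> (\<exists>w\<in>\<Omega>. norm (w - z - t *\<^sub>R v) < e * t)"
        by blast
    qed
  qed blast
  finally show ?thesis .
qed

lemma mem_paratingent_cone_iff:
  "v \<in> paratingent_cone \<Omega> zb \<longleftrightarrow>
   (\<forall>e>0. \<exists>z\<in>\<Omega>. \<exists>w\<in>\<Omega>. \<exists>t. dist z zb < e \<and> 0 < t \<and> t < e \<and> norm (w - z - t *\<^sub>R v) < e * t)"
  (is "?L \<longleftrightarrow> ?R")
proof -
  have "?L \<longleftrightarrow> (\<forall>e>0. \<forall>d>0. \<exists>z\<in>\<Omega>. \<exists>t. dist z zb < d \<and> 0 < t \<and> t < d \<and>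
                   (\<exists>w\<in>\<Omega>. norm (w - z - t *\<^sub>R v) < e * t))"
    unfolding paratingent_cone_def mem_set_Limsup_iff frequently_base_point_scale diff_quotient_set_def
    by (simp add: dist_diff_quotient cong: conj_cong)
  also have "\<dots> \<longleftrightarrow> ?R"
  proof
    assume R: ?R
    show "\<forall>e>0. \<forall>d>0. \<exists>z\<in>\<Omega>. \<exists>t. dist z zb < d \<and> 0 < t \<and> t < d \<and>
                   (\<exists>w\<in>\<Omega>. norm (w - z - t *\<^sub>R v) < e * t)"
    proof (intro allI impI)
      fix e d :: real assume "e > 0" "d > 0"
      then obtain z w t where wt: "z \<in> \<Omega>" "w \<in> \<Omega>" "dist z zb < min e d" "0 < t" "t < min e d"
          "norm (w - z - t *\<^sub>R v) < min e d * t"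
        using R[rule_format, of "min e d"] by auto
      moreover have "min e d * t \<le> e * t" using wt(4) by (intro mult_right_mono) auto
      ultimately have "dist z zb < d" "t < d" "norm (w - z - t *\<^sub>R v) < e * t" by linarith+
      with wt show "\<exists>z\<in>\<Omega>. \<exists>t. dist z zb < d \<and> 0 < t \<and> t < d \<and>
                   (\<exists>w\<in>\<Omega>. norm (w - z - t *\<^sub>R v) < e * t)"
        by blast
    qed
  qed blast
  finally show ?thesis .
qed

lemma mem_regular_tangent_cone_iff:
  assumes "zb \<in> \<Omega>"
  shows "v \<in> regular_tangent_cone \<Omega> zb \<longleftrightarrow>
   (\<forall>e>0. \<exists>d>0. \<forall>z\<in>\<Omega>. \<forall>t. dist z zb < d \<longrightarrow> 0 < t \<longrightarrow> t < d \<longrightarrow>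
      (\<exists>w\<in>\<Omega>. norm (w - z - t *\<^sub>R v) < e * t))"
  unfolding regular_tangent_cone_def mem_set_Liminf_iff[OF base_point_scale_nontrivial[OF assms]]
    eventually_base_point_scale diff_quotient_set_def
  by (simp add: dist_diff_quotient cong: imp_cong)

lemma mem_limiting_normal_cone_iff:
  "x \<in> limiting_normal_cone \<Omega> zb \<longleftrightarrow>
   (\<forall>e>0. \<exists>z\<in>\<Omega>. dist z zb < e \<and> (\<exists>y\<in>regular_normal_cone \<Omega> z. dist x y < e))"
  (is "?L \<longleftrightarrow> ?R")
proof -
  have "?L \<longleftrightarrow> (\<forall>e>0. \<forall>d>0. \<exists>z\<in>\<Omega>. dist z zb < d \<and> (\<exists>y\<in>regular_normal_cone \<Omega> z. dist x y < e))"
    unfolding limiting_normal_cone_def mem_set_Limsup_iff frequently_nhds_in ..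
  also have "\<dots> \<longleftrightarrow> ?R"
  proof
    assume R: ?R
    show "\<forall>e>0. \<forall>d>0. \<exists>z\<in>\<Omega>. dist z zb < d \<and> (\<exists>y\<in>regular_normal_cone \<Omega> z. dist x y < e)"
    proof (intro allI impI)
      fix e d :: real assume "e > 0" "d > 0"
      then show "\<exists>z\<in>\<Omega>. dist z zb < d \<and> (\<exists>y\<in>regular_normal_cone \<Omega> z. dist x y < e)"
        using R[rule_format, of "min e d"] by auto
    qed
  qed blast
  finally show ?thesis .
qed

section \<open>Compactness principles for tangent directions\<close>

lemma locally_closed_at_imp_closed_Int_cball:
  fixes zb :: "'a::metric_space"
  assumes "locally_closed_at \<Omega> zb"
  obtains r where "r > 0" "closed (\<Omega> \<inter> cball zb r)"
proof -
  obtain V where V: "zb \<in> interior V" "closed (\<Omega> \<inter> V)"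
    using assms by (auto simp: locally_closed_at_def)
  then obtain r where r: "r > 0" "cball zb r \<subseteq> V"
    by (auto simp: mem_interior_cball)
  have "\<Omega> \<inter> cball zb r = (\<Omega> \<inter> V) \<inter> cball zb r" using r(2) by blast
  then show ?thesis using that r(1) V(2) by (metis closed_Int closed_cball)
qed

lemma tangent_cone_meets_compact:
  assumes "compact S" "\<And>d. d > 0 \<Longrightarrow> \<exists>w\<in>\<Omega>. \<exists>t. 0 < t \<and> t < d \<and> (w - z) /\<^sub>R t \<in> S"
  shows "\<exists>v\<in>tangent_cone \<Omega> z. v \<in> S"
proof -
  have "\<exists>\<^sub>F t in at_right 0. diff_quotient_set \<Omega> z t \<inter> S \<noteq> {}"
    unfolding frequently_at_right_0 diff_quotient_set_def using assms(2) by blast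
  from set_Limsup_meets_compact[OF assms(1) this] show ?thesis
    unfolding tangent_cone_def by blast
qed

lemma paratingent_cone_meets_compact:
  assumes "compact S"
    "\<And>d. d > 0 \<Longrightarrow> \<exists>z\<in>\<Omega>. \<exists>w\<in>\<Omega>. \<exists>t. dist z zb < d \<and> 0 < t \<and> t < d \<and> (w - z) /\<^sub>R t \<in> S"
  shows "\<exists>v\<in>paratingent_cone \<Omega> zb. v \<in> S"
proof -
  have "\<exists>\<^sub>F p in nhds_in \<Omega> zb \<times>\<^sub>F at_right 0. (case p of (z, t) \<Rightarrow> diff_quotient_set \<Omega> z t) \<inter> S \<noteq> {}"
    unfolding frequently_base_point_scale diff_quotient_set_def using assms(2) by fast
  from set_Limsup_meets_compact[OF assms(1) this] show ?thesis
    unfolding paratingent_cone_def by blast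
qed

text \<open>Bounded difference quotients that stay outside the \<open>e\<close>-neighbourhood of the paratingent cone
  lie in a compact set disjoint from that cone, so they cannot persist as the base point
  tends to \<open>zb\<close> and the scale to zero.\<close>

lemma paratingent_cone_uniform:
  fixes \<Omega> :: "'a::euclidean_space set"
  assumes "e > 0"
  shows "\<exists>d>0. \<forall>z\<in>\<Omega>. \<forall>w\<in>\<Omega>. \<forall>t. dist z zb < d \<longrightarrow> 0 < t \<longrightarrow> t < d \<longrightarrow> norm (w - z) \<le> M * t \<longrightarrow>
           (\<exists>v\<in>paratingent_cone \<Omega> zb. norm (w - z - t *\<^sub>R v) < e * t)"
proof (rule ccontr)
  assume contra: "\<not> ?thesis"
  \<comment> \<open>The difference quotients that would violate the claim.\<close>
  define S where "S = cball 0 M - (\<Union>v\<in>paratingent_cone \<Omega> zb. ball v e)"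
  have "compact S" unfolding S_def by (intro compact_diff compact_cball open_UN) auto
  moreover have "\<exists>z\<in>\<Omega>. \<exists>w\<in>\<Omega>. \<exists>t. dist z zb < d \<and> 0 < t \<and> t < d \<and> (w - z) /\<^sub>R t \<in> S"
    if "d > 0" for d
  proof -
    from contra that obtain z w t where *: "z \<in> \<Omega>" "w \<in> \<Omega>" "dist z zb < d" "0 < t" "t < d"
      "norm (w - z) \<le> M * t" "\<And>v. v \<in> paratingent_cone \<Omega> zb \<Longrightarrow> \<not> norm (w - z - t *\<^sub>R v) < e * t"
      by blast
    have "norm ((w - z) /\<^sub>R t) \<le> M"
      using *(4,6) by (simp add: pos_divide_le_eq divide_inverse_commute[symmetric])
    moreover have "(w - z) /\<^sub>R t \<notin> ball v e" if "v \<in> paratingent_cone \<Omega> zb" for v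
      using *(7)[OF that] dist_diff_quotient[OF *(4), of v w z e] by simp
    ultimately have "(w - z) /\<^sub>R t \<in> S" unfolding S_def by auto
    then show ?thesis using *(1-5) by blast
  qed
  ultimately obtain v where "v \<in> paratingent_cone \<Omega> zb" "v \<in> S"
    using paratingent_cone_meets_compact[of S \<Omega> zb] by blast
  then show False using assms by (auto simp: S_def)
qed

lemma regular_tangent_cone_uniform:
  fixes \<Omega> :: "'a::real_normed_vector set"
  assumes "zb \<in> \<Omega>" "compact S" "S \<subseteq> regular_tangent_cone \<Omega> zb" "e > 0"
  shows "\<exists>d>0. \<forall>z\<in>\<Omega>. \<forall>t. dist z zb < d \<longrightarrow> 0 < t \<longrightarrow> t < d \<longrightarrow>
           (\<forall>v\<in>S. \<exists>w\<in>\<Omega>. norm (w - z - t *\<^sub>R v) < e * t)"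
  using set_Liminf_uniform_on_compact[OF base_point_scale_nontrivial[OF assms(1)] assms(2)
      assms(3)[unfolded regular_tangent_cone_def] assms(4)]
  unfolding eventually_base_point_scale diff_quotient_set_def
  by (simp add: dist_diff_quotient cong: imp_cong)

section \<open>Convexity and symmetry of the tangent cones\<close>

lemma tangent_subset_paratingent_cone:
  assumes "zb \<in> \<Omega>"
  shows "tangent_cone \<Omega> zb \<subseteq> paratingent_cone \<Omega> zb"
proof
  fix v assume v: "v \<in> tangent_cone \<Omega> zb"
  show "v \<in> paratingent_cone \<Omega> zb"
    unfolding mem_paratingent_cone_iff
  proof (intro allI impI)
    fix e :: real assume "e > 0"
    then obtain w t where "w \<in> \<Omega>" "0 < t" "t < e" "norm (w - zb - t *\<^sub>R v) < e * t"
      using v unfolding mem_tangent_cone_iff by blast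
    with assms \<open>e > 0\<close> show "\<exists>z\<in>\<Omega>. \<exists>w\<in>\<Omega>. \<exists>t. dist z zb < e \<and> 0 < t \<and> t < e \<and>
        norm (w - z - t *\<^sub>R v) < e * t"
      by (intro bexI[of _ zb] bexI[of _ w] exI[of _ t]) auto
  qed
qed

lemma regular_tangent_subset_tangent_cone:
  assumes "zb \<in> \<Omega>"
  shows "regular_tangent_cone \<Omega> zb \<subseteq> tangent_cone \<Omega> zb"
proof
  fix v assume v: "v \<in> regular_tangent_cone \<Omega> zb"
  show "v \<in> tangent_cone \<Omega> zb"
    unfolding mem_tangent_cone_iff
  proof (intro allI impI)
    fix e :: real assume "e > 0"
    then obtain d where d: "d > 0" "\<forall>z\<in>\<Omega>. \<forall>t. dist z zb < d \<longrightarrow> 0 < t \<longrightarrow> t < d \<longrightarrow>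
      (\<exists>w\<in>\<Omega>. norm (w - z - t *\<^sub>R v) < e * t)"
      using v mem_regular_tangent_cone_iff[OF assms] by blast
    obtain t where "0 < t" "t < min d e" using \<open>e > 0\<close> d(1) by (metis dense min_less_iff_conj)
    then show "\<exists>w\<in>\<Omega>. \<exists>t. 0 < t \<and> t < e \<and> norm (w - zb - t *\<^sub>R v) < e * t"
      using d assms by (metis dist_self min_less_iff_conj)
  qed
qed

lemma zero_mem_regular_tangent_cone:
  assumes "zb \<in> \<Omega>"
  shows "0 \<in> regular_tangent_cone \<Omega> zb"
  unfolding mem_regular_tangent_cone_iff[OF assms]
  by (auto intro!: exI[of _ 1] bexI)

lemma scaleR_mem_regular_tangent_cone:
  assumes "zb \<in> \<Omega>" "v \<in> regular_tangent_cone \<Omega> zb" "c > 0"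
  shows "c *\<^sub>R v \<in> regular_tangent_cone \<Omega> zb"
  unfolding mem_regular_tangent_cone_iff[OF assms(1)]
proof (intro allI impI)
  fix e :: real assume "e > 0"
  then have "e / c > 0" using assms(3) by simp
  then obtain d where d: "d > 0" "\<forall>z\<in>\<Omega>. \<forall>t. dist z zb < d \<longrightarrow> 0 < t \<longrightarrow> t < d \<longrightarrow>
      (\<exists>w\<in>\<Omega>. norm (w - z - t *\<^sub>R v) < (e/c) * t)"
    using assms(2) mem_regular_tangent_cone_iff[OF assms(1)] by blast
  show "\<exists>d>0. \<forall>z\<in>\<Omega>. \<forall>t. dist z zb < d \<longrightarrow> 0 < t \<longrightarrow> t < d \<longrightarrow>
      (\<exists>w\<in>\<Omega>. norm (w - z - t *\<^sub>R c *\<^sub>R v) < e * t)"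
  proof (intro exI[of _ "min d (d / c)"] conjI ballI allI impI)
    fix z t assume *: "z \<in> \<Omega>" "dist z zb < min d (d/c)" "0 < t" "t < min d (d/c)"
    then have "0 < c * t" "c * t < d" using assms(3) by (auto simp: field_simps)
    moreover have "dist z zb < d" using *(2) by simp
    ultimately obtain w where "w \<in> \<Omega>" "norm (w - z - (c * t) *\<^sub>R v) < (e/c) * (c * t)"
      using d(2) *(1) by blast
    then show "\<exists>w\<in>\<Omega>. norm (w - z - t *\<^sub>R c *\<^sub>R v) < e * t"
      using assms(3) by (auto simp: mult.commute)
  qed (use d assms in auto)
qed

text \<open>Move by the first vector from \<open>z\<close> to a point \<open>y\<close> of the set, then by the second from \<open>y\<close>:
  this is allowed because \<open>y\<close> is again a base point near \<open>zb\<close>. The same argument is not available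
  for the tangent cone, whose base point is fixed.\<close>

lemma add_mem_regular_tangent_cone:
  assumes "zb \<in> \<Omega>" "u \<in> regular_tangent_cone \<Omega> zb" "v \<in> regular_tangent_cone \<Omega> zb"
  shows "u + v \<in> regular_tangent_cone \<Omega> zb"
  unfolding mem_regular_tangent_cone_iff[OF assms(1)]
proof (intro allI impI)
  fix e :: real assume "e > 0"
  then have e2: "e / 2 > 0" by simp
  obtain c where c: "c > 0" "\<forall>z\<in>\<Omega>. \<forall>t. dist z zb < c \<longrightarrow> 0 < t \<longrightarrow> t < c \<longrightarrow>
      (\<exists>w\<in>\<Omega>. norm (w - z - t *\<^sub>R u) < (e/2) * t)"
    using e2 assms(2) mem_regular_tangent_cone_iff[OF assms(1)] by blast
  obtain d where d: "d > 0" "\<forall>z\<in>\<Omega>. \<forall>t. dist z zb < d \<longrightarrow> 0 < t \<longrightarrow> t < d \<longrightarrow>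
      (\<exists>w\<in>\<Omega>. norm (w - z - t *\<^sub>R v) < (e/2) * t)"
    using e2 assms(3) mem_regular_tangent_cone_iff[OF assms(1)] by blast
  define k where "k = norm u + e / 2 + 1"
  have k: "k \<ge> 1" using e2 by (simp add: k_def)
  define b where "b = min c (min (d/2) (d / (2*k)))"
  show "\<exists>d>0. \<forall>z\<in>\<Omega>. \<forall>t. dist z zb < d \<longrightarrow> 0 < t \<longrightarrow> t < d \<longrightarrow>
      (\<exists>w\<in>\<Omega>. norm (w - z - t *\<^sub>R (u + v)) < e * t)"
  proof (intro exI[of _ b] conjI ballI allI impI)
    show "0 < b" using c d k by (auto simp: b_def)
    fix z t assume *: "z \<in> \<Omega>" "dist z zb < b" "0 < t" "t < b"
    then obtain y where y: "y \<in> \<Omega>" "norm (y - z - t *\<^sub>R u) < (e/2) * t"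
      using c(2) by (auto simp: b_def)
    have "norm (y - z) \<le> norm (t *\<^sub>R u) + norm (y - z - t *\<^sub>R u)"
      by (rule norm_triangle_sub)
    also have "\<dots> \<le> k * t" using y(2) *(3) by (simp add: k_def algebra_simps)
    also have "\<dots> < d / 2" using *(3,4) k by (simp add: b_def field_simps)
    finally have "dist y zb < d"
      using dist_triangle[of y zb z] *(2) by (simp add: b_def dist_norm)
    moreover have "t < d" using *(4) d(1) by (simp add: b_def)
    ultimately obtain w where w: "w \<in> \<Omega>" "norm (w - y - t *\<^sub>R v) < (e/2) * t"
      using d(2) y(1) *(3) by blast
    have "w - z - t *\<^sub>R (u + v) = (w - y - t *\<^sub>R v) + (y - z - t *\<^sub>R u)"
      by (simp add: algebra_simps)
    then have "norm (w - z - t *\<^sub>R (u + v)) \<le> norm (w - y - t *\<^sub>R v) + norm (y - z - t *\<^sub>R u)"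
      by (metis norm_triangle_ineq)
    also have "\<dots> < e * t" using y(2) w(2) by simp
    finally show "\<exists>w\<in>\<Omega>. norm (w - z - t *\<^sub>R (u + v)) < e * t" using w(1) by blast
  qed
qed

text \<open>The definition asks only the base point to be close to \<open>zb\<close>. The second point is then close,
  too, since its distance from the base point is of the order of the scale. This makes the two
  points interchangeable.\<close>

lemma paratingent_cone_both_near:
  assumes "v \<in> paratingent_cone \<Omega> zb" "e > 0"
  shows "\<exists>z\<in>\<Omega>. \<exists>w\<in>\<Omega>. \<exists>t. dist z zb < e \<and> dist w zb < e \<and> 0 < t \<and> t < e \<and>
           norm (w - z - t *\<^sub>R v) < e * t"
proof -
  define k where "k = norm v + 2"
  have k: "k \<ge> 2" by (simp add: k_def)
  \<comment> \<open>\<open>b * k\<close> bounds the distance of \<open>w\<close> from \<open>zb\<close>: the base point contributes \<open>b\<close>, the move at most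
      \<open>b * (norm v + 1)\<close>.\<close>
  define b where "b = min 1 (e / k)"
  have b: "b > 0" "b \<le> 1" "b * k \<le> e" using \<open>e > 0\<close> k
    by (auto simp: b_def field_simps min_def)
  have "b * 1 \<le> b * k" using b k by (intro mult_left_mono) auto
  with b have "b \<le> e" by linarith
  obtain z w t where *: "z \<in> \<Omega>" "w \<in> \<Omega>" "dist z zb < b" "0 < t" "t < b"
    "norm (w - z - t *\<^sub>R v) < b * t"
    using assms b(1) unfolding mem_paratingent_cone_iff by blast
  have "norm (w - z) \<le> norm (t *\<^sub>R v) + norm (w - z - t *\<^sub>R v)"
    by (rule norm_triangle_sub)
  also have "\<dots> \<le> t * norm v + b * t" using * by simp
  also have "\<dots> \<le> t * norm v + 1 * t" using * b by (intro add_left_mono mult_right_mono) auto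
  also have "\<dots> = t * (norm v + 1)" by (simp add: algebra_simps)
  also have "\<dots> \<le> b * (norm v + 1)" using * by (intro mult_right_mono) auto
  finally have "dist w zb < b * k"
    using dist_triangle[of w zb z] *(3) by (simp add: dist_norm k_def algebra_simps)
  then have "dist w zb < e" using b by linarith
  moreover have "norm (w - z - t *\<^sub>R v) < e * t"
    using *(6) mult_right_mono[OF \<open>b \<le> e\<close>, of t] *(4) by linarith
  moreover have "t < e" "dist z zb < e" using * \<open>b \<le> e\<close> by linarith+
  ultimately show ?thesis using *(1,2,4) by blast
qed

text \<open>Exchange the two points of the difference quotient.\<close>

lemma uminus_mem_paratingent_cone:
  assumes "v \<in> paratingent_cone \<Omega> zb"
  shows "- v \<in> paratingent_cone \<Omega> zb"
  unfolding mem_paratingent_cone_iff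
proof (intro allI impI)
  fix e :: real assume "e > 0"
  then obtain z w t where *: "z \<in> \<Omega>" "w \<in> \<Omega>" "dist w zb < e" "0 < t" "t < e"
    "norm (w - z - t *\<^sub>R v) < e * t"
    using paratingent_cone_both_near[OF assms] by blast
  have "z - w - t *\<^sub>R (- v) = - (w - z - t *\<^sub>R v)" by simp
  then have "norm (z - w - t *\<^sub>R (- v)) < e * t" using *(6) by (metis norm_minus_cancel)
  with * show "\<exists>z\<in>\<Omega>. \<exists>w\<in>\<Omega>. \<exists>t. dist z zb < e \<and> 0 < t \<and> t < e \<and> norm (w - z - t *\<^sub>R - v) < e * t"
    by blast
qed

lemma subspace_regular_tangent_cone_iff:
  assumes "zb \<in> \<Omega>"
  shows "subspace (regular_tangent_cone \<Omega> zb) \<longleftrightarrow>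
         (\<forall>v\<in>regular_tangent_cone \<Omega> zb. - v \<in> regular_tangent_cone \<Omega> zb)" (is "_ \<longleftrightarrow> ?R")
proof
  assume R: ?R
  show "subspace (regular_tangent_cone \<Omega> zb)"
  proof (rule subspaceI)
    fix c :: real and v assume v: "v \<in> regular_tangent_cone \<Omega> zb"
    consider "c > 0" | "c = 0" | "- c > 0" by linarith
    then show "c *\<^sub>R v \<in> regular_tangent_cone \<Omega> zb"
    proof cases
      case 3
      then show ?thesis
        using scaleR_mem_regular_tangent_cone[OF assms R[rule_format, OF v] 3] by simp
    qed (use v assms zero_mem_regular_tangent_cone scaleR_mem_regular_tangent_cone in auto)
  qed (use assms zero_mem_regular_tangent_cone add_mem_regular_tangent_cone in auto)
qed (auto intro: subspace_neg)

lemma strictly_smooth_iff_eq: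
  "strictly_smooth \<Omega> zb \<longleftrightarrow> regular_tangent_cone \<Omega> zb = paratingent_cone \<Omega> zb"
  unfolding strictly_smooth_def set_Lim_exists_def paratingent_cone_def regular_tangent_cone_def ..

lemma strictly_smoothI:
  assumes "zb \<in> \<Omega>" "paratingent_cone \<Omega> zb \<subseteq> regular_tangent_cone \<Omega> zb"
  shows "strictly_smooth \<Omega> zb"
  unfolding strictly_smooth_iff_eq
  using assms tangent_subset_paratingent_cone[OF assms(1)]
    regular_tangent_subset_tangent_cone[OF assms(1)] by order

text \<open>The regular tangent cone is convex and the paratingent cone is symmetric, so their common
  value is a subspace; the tangent cone lies between them.\<close>

lemma strictly_smooth_cones:
  assumes "zb \<in> \<Omega>" "strictly_smooth \<Omega> zb"
  shows "paratingent_cone \<Omega> zb = regular_tangent_cone \<Omega> zb"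
    "tangent_cone \<Omega> zb = regular_tangent_cone \<Omega> zb"
    "subspace (regular_tangent_cone \<Omega> zb)"
proof -
  show 1: "paratingent_cone \<Omega> zb = regular_tangent_cone \<Omega> zb"
    using assms(2) by (simp add: strictly_smooth_iff_eq)
  then show "tangent_cone \<Omega> zb = regular_tangent_cone \<Omega> zb"
    using tangent_subset_paratingent_cone[OF assms(1)] regular_tangent_subset_tangent_cone[OF assms(1)]
    by blast
  show "subspace (regular_tangent_cone \<Omega> zb)"
    unfolding subspace_regular_tangent_cone_iff[OF assms(1)] unfolding 1[symmetric]
    by (simp add: uminus_mem_paratingent_cone)
qed

section \<open>Duality between regular tangents and limiting normals\<close>

lemma polar_cone_subspace:
  assumes "subspace V"
  shows "polar_cone V = orthogonal_comp V"
proof -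
  have "v \<bullet> a = 0" if "\<forall>a\<in>V. v \<bullet> a \<le> 0" "a \<in> V" for v a
    using that(1)[rule_format, OF that(2)] that(1)[rule_format, OF subspace_neg[OF assms that(2)]]
    by (simp add: inner_minus_right)
  then show ?thesis
    by (auto simp: polar_cone_def orthogonal_comp_def orthogonal_def inner_commute)
qed

lemma dim_orthogonal_comp:
  fixes V :: "'a::euclidean_space set"
  assumes "subspace V"
  shows "dim (orthogonal_comp V) = DIM('a) - dim V"
proof -
  have "orthogonal_comp V = {y \<in> UNIV. \<forall>x \<in> V. orthogonal x y}"
    by (auto simp: orthogonal_comp_def)
  then show ?thesis
    using dim_subspace_orthogonal_to_vectors[OF assms subspace_UNIV] by simp
qed

text \<open>A regular tangent \<open>v\<close> at \<open>zb\<close> is within \<open>e\<close> of an ordinary tangent at every nearby point of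
  the set, and the regular normals there have nonpositive inner product with that tangent. As \<open>e\<close>
  tends to \<open>0\<close>, limits of such normals inherit a nonpositive inner product with \<open>v\<close>.\<close>

lemma limiting_normal_subset_polar_regular_tangent_cone:
  fixes \<Omega> :: "'a::euclidean_space set"
  assumes "zb \<in> \<Omega>"
  shows "limiting_normal_cone \<Omega> zb \<subseteq> polar_cone (regular_tangent_cone \<Omega> zb)"
proof
  fix n assume n: "n \<in> limiting_normal_cone \<Omega> zb"
  show "n \<in> polar_cone (regular_tangent_cone \<Omega> zb)"
    unfolding polar_cone_def
  proof (intro CollectI ballI)
    fix v assume v: "v \<in> regular_tangent_cone \<Omega> zb"
    define K where "K = norm n + norm v + 2"
    have K: "K > 0" by (simp add: K_def add_nonneg_pos)
    have bound: "n \<bullet> v \<le> e * K" if e: "e > 0" "e \<le> 1" for e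
    proof -
      obtain d where d: "d > 0" "\<forall>z\<in>\<Omega>. \<forall>t. dist z zb < d \<longrightarrow> 0 < t \<longrightarrow> t < d \<longrightarrow>
          (\<exists>w\<in>\<Omega>. norm (w - z - t *\<^sub>R v) < e * t)"
        using v e mem_regular_tangent_cone_iff[OF assms] by blast
      obtain z y where zy: "z \<in> \<Omega>" "dist z zb < min d e" "y \<in> regular_normal_cone \<Omega> z"
        "dist n y < min d e"
        using n d(1) e(1) unfolding mem_limiting_normal_cone_iff by (metis min_less_iff_conj)
      have "\<exists>\<tau>\<in>tangent_cone \<Omega> z. \<tau> \<in> cball v e"
      proof (rule tangent_cone_meets_compact)
        fix b :: real assume "b > 0"
        obtain t where t: "0 < t" "t < min b d" using \<open>b > 0\<close> d(1) by (metis dense min_less_iff_conj)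
        then obtain w where w: "w \<in> \<Omega>" "norm (w - z - t *\<^sub>R v) < e * t" using d zy by auto
        then have "dist v ((w - z) /\<^sub>R t) < e" using dist_diff_quotient[OF t(1)] by blast
        then show "\<exists>w\<in>\<Omega>. \<exists>t. 0 < t \<and> t < b \<and> (w - z) /\<^sub>R t \<in> cball v e"
          using w t by (intro bexI[of _ w] exI[of _ t]) auto
      qed simp
      then obtain \<tau> where \<tau>: "\<tau> \<in> tangent_cone \<Omega> z" "norm (v - \<tau>) \<le> e"
        by (auto simp: dist_norm)
      have "y \<bullet> \<tau> \<le> 0" using zy(3) \<tau>(1) by (auto simp: regular_normal_cone_def polar_cone_def)
      moreover have "n \<bullet> v = y \<bullet> \<tau> + (n - y) \<bullet> v + y \<bullet> (v - \<tau>)"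
        by (simp add: inner_simps)
      moreover have "(n - y) \<bullet> v \<le> e * norm v"
      proof -
        have "(n - y) \<bullet> v \<le> norm (n - y) * norm v" by (rule norm_cauchy_schwarz)
        also have "\<dots> \<le> e * norm v" using zy(4) by (intro mult_right_mono) (auto simp: dist_norm)
        finally show ?thesis .
      qed
      moreover have "y \<bullet> (v - \<tau>) \<le> (norm n + 1) * e"
      proof -
        have "norm y \<le> norm n + 1" using zy(4) e norm_triangle_sub[of y n]
          by (simp add: dist_norm norm_minus_commute)
        then have "norm y * norm (v - \<tau>) \<le> (norm n + 1) * e" using \<tau>(2) by (intro mult_mono) auto
        then show ?thesis using norm_cauchy_schwarz[of y "v - \<tau>"] by linarith
      qed
      ultimately show ?thesis using e by (simp add: K_def algebra_simps)
    qed
    show "n \<bullet> v \<le> 0"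
    proof (rule field_le_epsilon)
      fix e :: real assume "e > 0"
      have "n \<bullet> v \<le> min 1 (e / K) * K" using \<open>e > 0\<close> K by (intro bound) auto
      also have "\<dots> \<le> (e / K) * K" using K by (intro mult_right_mono) auto
      finally show "n \<bullet> v \<le> 0 + e" using K by simp
    qed
  qed
qed

lemma regular_normal_subset_limiting_normal_cone:
  assumes "zb \<in> \<Omega>"
  shows "regular_normal_cone \<Omega> zb \<subseteq> limiting_normal_cone \<Omega> zb"
proof
  fix y assume "y \<in> regular_normal_cone \<Omega> zb"
  then show "y \<in> limiting_normal_cone \<Omega> zb"
    unfolding mem_limiting_normal_cone_iff using assms
    by (intro allI impI bexI[of _ zb] conjI bexI[of _ y]) auto
qed

text \<open>If \<open>p\<close> is locally a nearest point to \<open>x\<close>, then \<open>\<bar>x - p\<bar>\<^sup>2 \<le> \<bar>x - w\<bar>\<^sup>2\<close> gives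
  \<open>2 (x - p) \<bullet> (w - p) \<le> \<bar>w - p\<bar>\<^sup>2\<close>, and along a tangent direction the right-hand side is of second
  order in the scale.\<close>

lemma proximal_normal_mem_regular_normal_cone:
  fixes p x :: "'a::euclidean_space"
  assumes "d > 0" and closest: "\<And>w. w \<in> \<Omega> \<Longrightarrow> dist w p < d \<Longrightarrow> norm (x - p) \<le> norm (x - w)"
  shows "x - p \<in> regular_normal_cone \<Omega> p"
  unfolding regular_normal_cone_def polar_cone_def
proof (intro CollectI ballI)
  fix v assume v: "v \<in> tangent_cone \<Omega> p"
  define a where "a = x - p"
  show "(x - p) \<bullet> v \<le> 0"
  proof (rule ccontr)
    assume "\<not> ?thesis"
    then have c: "a \<bullet> v > 0" by (simp add: a_def)
    define k where "k = norm v + 1"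
    have k: "k \<ge> 1" by (simp add: k_def)
    define m where "m = 2 * norm a + k\<^sup>2"
    have m: "m > 0" using k by (simp add: m_def add_nonneg_pos)
    define e where "e = min 1 (min (d / k) (a \<bullet> v / m))"
    have e: "e > 0" "e \<le> 1" "e * k \<le> d" "e * m \<le> a \<bullet> v"
      using k m c \<open>d > 0\<close> by (auto simp: e_def pos_le_divide_eq[symmetric])
    obtain w t where w: "w \<in> \<Omega>" "0 < t" "t < e" "norm (w - p - t *\<^sub>R v) < e * t"
      using v e(1) unfolding mem_tangent_cone_iff by blast
    define q where "q = w - p"
    have q: "norm q \<le> t * k"
    proof -
      have "norm q \<le> norm (t *\<^sub>R v) + norm (q - t *\<^sub>R v)" by (rule norm_triangle_sub)
      also have "\<dots> \<le> t * norm v + e * t" using w by (simp add: q_def)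
      also have "\<dots> \<le> t * norm v + 1 * t" using e w by (intro add_left_mono mult_right_mono) auto
      finally show ?thesis by (simp add: k_def algebra_simps)
    qed
    also have "\<dots> < e * k" using w k by (intro mult_strict_right_mono) auto
    finally have "norm (x - p) \<le> norm (x - w)"
      using e(3) by (intro closest[OF w(1)]) (simp add: q_def dist_norm)
    then have "norm a \<le> norm (a - q)" by (simp add: a_def q_def)
    then have "a \<bullet> a \<le> (a - q) \<bullet> (a - q)" by (simp add: norm_le)
    then have "2 * (a \<bullet> q) \<le> (norm q)\<^sup>2"
      by (simp add: inner_diff_left inner_diff_right inner_commute power2_norm_eq_inner)
    also have "\<dots> \<le> (t * k)\<^sup>2" using q by (intro power_mono) auto
    also have "\<dots> \<le> t * (e * k\<^sup>2)" using w k
      by (simp add: power2_eq_square mult.assoc mult_left_mono mult_right_mono)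
    finally have 1: "2 * (a \<bullet> q) \<le> t * (e * k\<^sup>2)" .
    have "a \<bullet> (t *\<^sub>R v - q) \<le> norm a * norm (t *\<^sub>R v - q)" by (rule norm_cauchy_schwarz)
    also have "\<dots> \<le> norm a * (e * t)" using w by (intro mult_left_mono) (auto simp: q_def norm_minus_commute)
    finally have "t * (2 * (a \<bullet> v)) \<le> t * (e * m)"
      using 1 by (simp add: inner_diff_right m_def algebra_simps)
    then have "2 * (a \<bullet> v) \<le> e * m" using w by simp
    with e c show False by linarith
  qed
qed

text \<open>A mean value argument for the distance to the set along the segment from \<open>z\<close> to \<open>z + T v\<close>. The
  distance grows from \<open>0\<close> to at least \<open>2 c T\<close>, hence at some time its rate of growth is at least \<open>c\<close>.
  Let \<open>p\<close> be a point of the set nearest to \<open>x = z + s v\<close> at that time \<open>s\<close>. The distance to the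
  fixed point \<open>p\<close> grows at least as fast, and its rate is the inner product of \<open>v\<close> with the unit vector from \<open>p\<close> to \<open>x\<close>, which is a
  regular normal at \<open>p\<close>.\<close>

lemma regular_normal_of_missed_direction:
  fixes \<Omega> :: "'a::euclidean_space set"
  assumes clo: "closed (\<Omega> \<inter> cball zb r)" and z: "z \<in> \<Omega>" and T: "T > 0" and c: "c > 0"
    and near: "dist z zb + 2 * T * norm v < r"
    and miss: "\<And>w. w \<in> \<Omega> \<Longrightarrow> 2 * c * T \<le> norm (w - z - T *\<^sub>R v)"
  shows "\<exists>p\<in>\<Omega>. dist p zb \<le> dist z zb + 2 * T * norm v \<and>
           (\<exists>n\<in>regular_normal_cone \<Omega> p. norm n = 1 \<and> c \<le> n \<bullet> v)"
proof -
  define A where "A = \<Omega> \<inter> cball zb r"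
  have "0 \<le> 2 * T * norm v" using T by simp
  then have zA: "z \<in> A" using z near unfolding A_def by (auto simp: dist_commute)
  define \<phi> where "\<phi> t = infdist (z + t *\<^sub>R v) A" for t
  have contphi: "continuous_on UNIV \<phi>" unfolding \<phi>_def by (intro continuous_intros)
  \<comment> \<open>The offset \<open>c'\<close> keeps the point found below outside the set, so that its direction from the
      nearest point is defined.\<close>
  define c' where "c' = c * T / 2"
  have c': "c' > 0" using T c by (simp add: c'_def)
  have "2 * c * T \<le> \<phi> T"
    unfolding \<phi>_def
  proof (subst infdist_notempty)
    show "A \<noteq> {}" using zA by blast
    show "2 * c * T \<le> (INF a\<in>A. dist (z + T *\<^sub>R v) a)"
    proof (rule cINF_greatest)
      fix a assume "a \<in> A"
      then have "2 * c * T \<le> norm (a - z - T *\<^sub>R v)" using miss A_def by blast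
      also have "\<dots> = dist (z + T *\<^sub>R v) a" by (simp add: dist_norm norm_minus_commute algebra_simps)
      finally show "2 * c * T \<le> dist (z + T *\<^sub>R v) a" .
    qed (use zA in blast)
  qed
  moreover have "0 < c * T" using c T by simp
  ultimately have phiT: "c * T + c' < \<phi> T" unfolding c'_def by linarith
  \<comment> \<open>At the last time in \<open>S\<close> the distance is not above the line of slope \<open>c\<close>; from then on it is.\<close>
  define S where "S = {t \<in> {0..T}. \<phi> t \<le> c * t + c'}"
  have "closed {t. \<phi> t \<le> c * t + c'}"
    by (intro closed_Collect_le continuous_intros contphi)
  then have "compact ({0..T} \<inter> {t. \<phi> t \<le> c * t + c'})" by (intro compact_Int_closed) auto
  then have "compact S" by (simp add: S_def Int_def)
  moreover have "0 \<in> S" using c' T zA by (auto simp: S_def \<phi>_def)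
  ultimately obtain s where s: "s \<in> S" "\<And>t. t \<in> S \<Longrightarrow> t \<le> s"
    using compact_attains_sup[of S] by blast
  have "s \<noteq> T" using s(1) phiT by (auto simp: S_def)
  then have sT: "0 \<le> s" "s < T" using s(1) by (auto simp: S_def)
  have after: "c * t + c' < \<phi> t" if "s < t" "t \<le> T" for t
    using s(2)[of t] that sT by (force simp: S_def)
  define x where "x = z + s *\<^sub>R v"
  obtain p where p: "p \<in> A" "infdist x A = dist x p"
    using infdist_attains_inf[of A x] clo zA unfolding A_def by blast
  define a where "a = x - p"
  have na: "norm a \<le> c * s + c'" using s(1) p(2) by (simp add: S_def \<phi>_def x_def a_def dist_norm)
  have grow: "norm a + c * h < norm (a + h *\<^sub>R v)" if "0 < h" "h \<le> T - s" for h
  proof -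
    have "\<phi> (s + h) \<le> dist (z + (s + h) *\<^sub>R v) p"
      unfolding \<phi>_def by (rule infdist_le[OF p(1)])
    also have "\<dots> = norm (a + h *\<^sub>R v)" by (simp add: dist_norm a_def x_def algebra_simps)
    finally show ?thesis using after[of "s + h"] that na by (simp add: algebra_simps)
  qed
  have "a \<noteq> 0"
  proof
    assume "a = 0"
    define h where "h = min (T - s) (c' / (norm v + 1))"
    have h: "0 < h" "h \<le> T - s" using sT c' by (auto simp: h_def add_nonneg_pos)
    have "\<phi> (s + h) \<le> dist (z + (s + h) *\<^sub>R v) p"
      unfolding \<phi>_def by (rule infdist_le[OF p(1)])
    also have "\<dots> = h * norm v"
    proof -
      have "z + (s + h) *\<^sub>R v - p = a + h *\<^sub>R v" by (simp add: a_def x_def algebra_simps)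
      then show ?thesis using \<open>a = 0\<close> h(1) by (simp add: dist_norm)
    qed
    also have "\<dots> \<le> h * (norm v + 1)" using h(1) by simp
    also have "\<dots> \<le> c' / (norm v + 1) * (norm v + 1)" by (intro mult_right_mono) (auto simp: h_def)
    also have "\<dots> = c'" by (simp add: add_nonneg_eq_0_iff)
    finally have "\<phi> (s + h) \<le> c'" .
    moreover have "0 \<le> c * (s + h)" using c h sT by simp
    ultimately show False using after[of "s + h"] h by linarith
  qed
  have "c * norm a \<le> a \<bullet> v"
  proof (rule ccontr)
    assume "\<not> ?thesis"
    then have gap: "0 < c * norm a - a \<bullet> v" by simp
    define h where "h = min (T - s) ((c * norm a - a \<bullet> v) / (norm v ^ 2 + 1))"
    have h: "0 < h" "h \<le> T - s" "h * (norm v ^ 2 + 1) \<le> c * norm a - a \<bullet> v"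
      using sT gap by (auto simp: h_def add_nonneg_pos pos_le_divide_eq[symmetric])
    have "0 \<le> norm a + c * h" using h(1) c by simp
    then have "(norm a + c * h)\<^sup>2 \<le> (norm (a + h *\<^sub>R v))\<^sup>2"
      using grow[OF h(1,2)] by (intro power_mono) auto
    also have "\<dots> = (norm a)\<^sup>2 + h * (2 * (a \<bullet> v)) + h * (h * (norm v)\<^sup>2)"
      unfolding power2_norm_eq_inner by (simp add: inner_simps inner_commute algebra_simps)
    finally have "h * (2 * c * norm a) + (c * h)\<^sup>2 \<le> h * (2 * (a \<bullet> v) + h * (norm v)\<^sup>2)"
      by (simp add: power2_sum algebra_simps)
    then have "h * (2 * c * norm a) \<le> h * (2 * (a \<bullet> v) + h * (norm v)\<^sup>2)"
      using zero_le_power2[of "c * h"] by linarith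
    then have "2 * c * norm a \<le> 2 * (a \<bullet> v) + h * (norm v)\<^sup>2" using h(1) by simp
    with h gap show False by (simp add: algebra_simps)
  qed
  have "dist x p \<le> dist x z" using infdist_le[OF zA, of x] p(2) by simp
  also have "\<dots> \<le> T * norm v" using sT by (simp add: x_def dist_norm mult_right_mono)
  finally have "dist p z \<le> 2 * (T * norm v)"
    using dist_triangle[of p z x] \<open>dist x z \<le> T * norm v\<close> by (simp add: dist_commute)
  then have pz: "dist p zb \<le> dist z zb + 2 * T * norm v"
    using dist_triangle[of p zb z] by linarith
  have "a \<in> regular_normal_cone \<Omega> p"
    unfolding a_def
  proof (rule proximal_normal_mem_regular_normal_cone)
    show "0 < r - dist p zb" using pz near by linarith
    fix w assume "w \<in> \<Omega>" "dist w p < r - dist p zb"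
    then have "w \<in> A" using dist_triangle[of w zb p] by (auto simp: A_def dist_commute)
    then show "norm (x - p) \<le> norm (x - w)"
      using infdist_le[of w A x] p(2) by (simp add: dist_norm)
  qed
  then have "a /\<^sub>R norm a \<in> regular_normal_cone \<Omega> p"
    by (auto simp: regular_normal_cone_def polar_cone_def mult_nonneg_nonpos)
  moreover have "norm (a /\<^sub>R norm a) = 1" using \<open>a \<noteq> 0\<close> by simp
  moreover have "c \<le> (a /\<^sub>R norm a) \<bullet> v"
    using \<open>c * norm a \<le> a \<bullet> v\<close> \<open>a \<noteq> 0\<close> by (simp add: field_simps)
  ultimately show ?thesis using p(1) pz A_def by blast
qed

text \<open>If \<open>v\<close> were not a regular tangent, then arbitrarily close to \<open>zb\<close> and at arbitrarily small
  scales the set would stay away from \<open>z + t v\<close> by a fixed fraction of \<open>t\<close>. Each such instance yields a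
  unit normal with inner product bounded below; a limit of these normals is a limiting normal that
  contradicts polarity.\<close>

lemma polar_limiting_normal_subset_regular_tangent_cone:
  fixes \<Omega> :: "'a::euclidean_space set"
  assumes "zb \<in> \<Omega>" "locally_closed_at \<Omega> zb"
  shows "polar_cone (limiting_normal_cone \<Omega> zb) \<subseteq> regular_tangent_cone \<Omega> zb"
proof
  fix v assume v: "v \<in> polar_cone (limiting_normal_cone \<Omega> zb)"
  show "v \<in> regular_tangent_cone \<Omega> zb"
  proof (rule ccontr)
    assume "\<not> ?thesis"
    then obtain e where e: "e > 0" and bad: "\<And>d. d > 0 \<Longrightarrow>
      \<exists>z\<in>\<Omega>. \<exists>t. dist z zb < d \<and> 0 < t \<and> t < d \<and> (\<forall>w\<in>\<Omega>. e * t \<le> norm (w - z - t *\<^sub>R v))"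
      unfolding mem_regular_tangent_cone_iff[OF assms(1)] by (metis linorder_not_less)
    obtain r where r: "r > 0" "closed (\<Omega> \<inter> cball zb r)"
      using locally_closed_at_imp_closed_Int_cball[OF assms(2)] .
    define S where "S = sphere 0 1 \<inter> {n. e/2 \<le> n \<bullet> v}"
    have "compact S" unfolding S_def
      by (intro compact_Int_closed closed_Collect_le continuous_intros) auto
    moreover have "\<exists>\<^sub>F p in nhds_in \<Omega> zb. regular_normal_cone \<Omega> p \<inter> S \<noteq> {}"
      unfolding frequently_nhds_in
    proof (intro allI impI)
      fix d :: real assume "d > 0"
      define k where "k = 1 + 2 * norm v"
      have k: "k > 0" by (simp add: k_def add_pos_nonneg)
      define b where "b = min d r / k"
      have b: "b > 0" "b * k = min d r" using k r(1) \<open>d > 0\<close> by (auto simp: b_def)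
      obtain z t where zt: "z \<in> \<Omega>" "dist z zb < b" "0 < t" "t < b"
          "\<And>w. w \<in> \<Omega> \<Longrightarrow> e * t \<le> norm (w - z - t *\<^sub>R v)"
        using bad[OF b(1)] by blast
      have "t * norm v \<le> b * norm v" using zt by (intro mult_right_mono) auto
      then have lt: "dist z zb + 2 * t * norm v < min d r"
        using zt(2) unfolding b(2)[symmetric] k_def by (simp add: algebra_simps)
      obtain p n where "p \<in> \<Omega>" "dist p zb \<le> dist z zb + 2 * t * norm v"
        "n \<in> regular_normal_cone \<Omega> p" "norm n = 1" "e/2 \<le> n \<bullet> v"
        using regular_normal_of_missed_direction[OF r(2) zt(1,3), of "e/2" v] lt zt(5) e by auto
      then show "\<exists>z\<in>\<Omega>. dist z zb < d \<and> regular_normal_cone \<Omega> z \<inter> S \<noteq> {}"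
        using lt by (intro bexI[of _ p]) (auto simp: S_def)
    qed
    ultimately obtain n where "n \<in> limiting_normal_cone \<Omega> zb" "n \<in> S"
      using set_Limsup_meets_compact unfolding limiting_normal_cone_def by blast
    then show False using v e by (auto simp: S_def polar_cone_def inner_commute)
  qed
qed

section \<open>Sets with a linear chart\<close>

text \<open>Near \<open>zb\<close>, a Lipschitz manifold is described up to first order by the linear map
  \<open>B = P \<circ> D\<Phi>(zb)\<close>, where \<open>P\<close> projects onto the parameter space of the graph: the set is Lipschitz over
  its image under \<open>B\<close> (\<open>expand\<close>), and from every nearby point one can move inside the set
  in every direction of \<open>range B\<close> (\<open>reach\<close>). The dimension of the manifold is that of \<open>range B\<close>. These
  two properties carry all the implications towards strict smoothness, so that the nonlinear change of
  coordinates \<open>\<Phi>\<close> need not be followed through the cones.\<close>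

locale linear_chart =
  fixes \<Omega> :: "'a::euclidean_space set" and zb :: 'a and B :: "'a \<Rightarrow> 'b::euclidean_space" and C :: real
  assumes base: "zb \<in> \<Omega>" and lin: "linear B" and C_pos: "C > 0"
    and expand: "\<exists>d>0. \<forall>z\<in>\<Omega>. \<forall>w\<in>\<Omega>. dist z zb < d \<longrightarrow> dist w zb < d \<longrightarrow>
                   norm (w - z) \<le> C * norm (B (w - z))"
    and reach: "x \<in> range B \<Longrightarrow> e > 0 \<Longrightarrow>
                  \<exists>d>0. \<forall>z\<in>\<Omega>. \<forall>t. dist z zb < d \<longrightarrow> 0 < t \<longrightarrow> t < d \<longrightarrow>
                    (\<exists>w\<in>\<Omega>. norm (w - z) \<le> C * norm x * t \<and> norm (B (w - z) - t *\<^sub>R x) \<le> e * t)"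
begin

lemma bound_B: obtains b where "b > 0" "\<And>x. norm (B x) \<le> b * norm x"
  using linear_bounded_pos[OF lin] by blast

text \<open>The expansion inequality divided by the scale. In particular \<open>B\<close> is injective on every
  subspace contained in the paratingent cone.\<close>

lemma paratingent_bound:
  assumes v: "v \<in> paratingent_cone \<Omega> zb"
  shows "norm v \<le> C * norm (B v)"
proof -
  obtain b where b: "b > 0" "\<And>x. norm (B x) \<le> b * norm x" using bound_B by blast
  obtain d where d: "d > 0" "\<forall>z\<in>\<Omega>. \<forall>w\<in>\<Omega>. dist z zb < d \<longrightarrow> dist w zb < d \<longrightarrow>
                   norm (w - z) \<le> C * norm (B (w - z))" using expand by blast
  define k where "k = 1 + C * b"
  have k: "k > 0" using b C_pos by (simp add: k_def add_pos_pos)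
  have main: "norm v \<le> C * norm (B v) + e * k" if e: "e > 0" "e \<le> d" for e
  proof -
    obtain z w t where *: "z \<in> \<Omega>" "w \<in> \<Omega>" "dist z zb < e" "dist w zb < e" "0 < t"
        "norm (w - z - t *\<^sub>R v) < e * t"
      using paratingent_cone_both_near[OF v e(1)] by blast
    define r where "r = w - z - t *\<^sub>R v"
    have r: "w - z = t *\<^sub>R v + r" "norm r \<le> e * t" using * by (auto simp: r_def)
    have "t * norm v = norm (t *\<^sub>R v)" using * by simp
    also have "\<dots> \<le> norm (w - z) + norm r" unfolding r(1) using norm_triangle_ineq4[of "t *\<^sub>R v + r" r] by simp
    also have "\<dots> \<le> C * norm (B (w - z)) + norm r"
      using d(2) * e(2) by auto
    also have "B (w - z) = t *\<^sub>R B v + B r"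
      unfolding r(1) using lin by (simp add: linear_add linear_cmul)
    also have "norm (t *\<^sub>R B v + B r) \<le> t * norm (B v) + b * norm r"
      using norm_triangle_ineq[of "t *\<^sub>R B v" "B r"] b(2)[of r] * by simp
    also have "C * (t * norm (B v) + b * norm r) + norm r = t * (C * norm (B v)) + k * norm r"
      by (simp add: k_def algebra_simps)
    also have "\<dots> \<le> t * (C * norm (B v)) + k * (e * t)" using r k by (intro add_left_mono mult_left_mono) auto
    finally have "t * norm v \<le> t * (C * norm (B v) + e * k)" using C_pos
      by (simp add: algebra_simps)
    then show ?thesis using * by simp
  qed
  show ?thesis
  proof (rule field_le_epsilon)
    fix e :: real assume "e > 0"
    have "norm v \<le> C * norm (B v) + min d (e / k) * k" using d k \<open>e > 0\<close> by (intro main) auto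
    also have "\<dots> \<le> C * norm (B v) + e / k * k" using k by (intro add_left_mono mult_right_mono) auto
    finally show "norm v \<le> C * norm (B v) + e" using k by simp
  qed
qed

lemma paratingent_kernel: "v \<in> paratingent_cone \<Omega> zb \<Longrightarrow> B v = 0 \<Longrightarrow> v = 0"
  using paratingent_bound[of v] by simp

lemma dim_image_of_subspace:
  assumes "subspace S" "S \<subseteq> paratingent_cone \<Omega> zb"
  shows "dim (B ` S) = dim S"
proof (rule dim_image_eq[OF lin])
  show "inj_on B (span S)"
  proof (rule inj_onI)
    fix u v assume "u \<in> span S" "v \<in> span S" "B u = B v"
    then have "u - v \<in> S" "B (u - v) = 0" 
      using assms(1) lin by (auto simp: span_eq_iff[THEN iffD2] subspace_diff linear_diff)
    then show "u = v" using paratingent_kernel assms(2) by force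
  qed
qed

text \<open>For a fixed base point \<open>z\<close>, the moves provided by \<open>reach\<close> have bounded difference quotients and
  accumulate at a tangent; the neighbourhood of admissible base points is that of \<open>reach\<close>. This uniformity is what makes the lemma applicable to limiting normals.\<close>

lemma range_subset_image_tangent_nearby:
  assumes "x \<in> range B" "e > 0"
  shows "\<exists>d>0. \<forall>z\<in>\<Omega>. dist z zb < d \<longrightarrow>
           (\<exists>v\<in>tangent_cone \<Omega> z. norm v \<le> C * norm x \<and> norm (B v - x) \<le> e)"
proof -
  obtain d where d: "d > 0" "\<forall>z\<in>\<Omega>. \<forall>t. dist z zb < d \<longrightarrow> 0 < t \<longrightarrow> t < d \<longrightarrow>
      (\<exists>w\<in>\<Omega>. norm (w - z) \<le> C * norm x * t \<and> norm (B (w - z) - t *\<^sub>R x) \<le> e * t)"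
    using reach[OF assms] by blast
  have "\<exists>v\<in>tangent_cone \<Omega> z. norm v \<le> C * norm x \<and> norm (B v - x) \<le> e"
    if z: "z \<in> \<Omega>" "dist z zb < d" for z
  proof -
    define S where "S = cball 0 (C * norm x) \<inter> {v. norm (B v - x) \<le> e}"
    have "closed {v. norm (B v - x) \<le> e}"
      using lin by (intro closed_Collect_le continuous_intros linear_continuous_on)
        (simp_all add: linear_conv_bounded_linear)
    then have "compact S" unfolding S_def by (intro compact_Int_closed) auto
    moreover have "\<exists>w\<in>\<Omega>. \<exists>t. 0 < t \<and> t < c \<and> (w - z) /\<^sub>R t \<in> S" if "c > 0" for c
    proof -
      obtain t where t: "0 < t" "t < min c d" using \<open>c > 0\<close> d(1) by (metis dense min_less_iff_conj)
      then obtain w where w: "w \<in> \<Omega>" "norm (w - z) \<le> C * norm x * t" "norm (B (w - z) - t *\<^sub>R x) \<le> e * t"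
        using d(2) z by auto
      have 1: "norm ((w - z) /\<^sub>R t) \<le> C * norm x"
        using w t by (simp add: pos_divide_le_eq divide_inverse_commute[symmetric])
      have "B ((w - z) /\<^sub>R t) - x = (B (w - z) - t *\<^sub>R x) /\<^sub>R t"
        using t lin by (simp add: linear_cmul linear_diff scaleR_diff_right)
      then have "norm (B ((w - z) /\<^sub>R t) - x) = norm (B (w - z) - t *\<^sub>R x) / t"
        using t by (simp add: divide_inverse_commute del: scaleR_diff_right)
      also have "\<dots> \<le> e" using w t by (simp add: pos_divide_le_eq)
      finally show ?thesis using 1 w(1) t by (intro bexI[of _ w] exI[of _ t]) (auto simp: S_def)
    qed
    ultimately obtain v where "v \<in> tangent_cone \<Omega> z" "v \<in> S"
      using tangent_cone_meets_compact[of S \<Omega> z] by blast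
    then show ?thesis by (intro bexI[of _ v]) (auto simp: S_def)
  qed
  with d(1) show ?thesis by blast
qed

text \<open>The approximate preimages of \<open>x\<close> lie in a compact part of the tangent cone.\<close>

lemma image_tangent_cone: "B ` tangent_cone \<Omega> zb = range B"
proof -
  have "x \<in> B ` tangent_cone \<Omega> zb" if x: "x \<in> range B" for x
  proof -
    define S where "S = tangent_cone \<Omega> zb \<inter> cball 0 (C * norm x)"
    have "compact S" unfolding S_def tangent_cone_def
      using closed_set_Limsup by (metis compact_Int_closed compact_cball inf_commute)
    then have "closed (B ` S)"
      using lin by (intro compact_imp_closed compact_continuous_image linear_continuous_on)
        (simp_all add: linear_conv_bounded_linear)
    moreover have "x \<in> closure (B ` S)"
      unfolding closure_approachable
    proof (intro allI impI)
      fix e :: real assume "e > 0"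
      then obtain v where "v \<in> tangent_cone \<Omega> zb" "norm v \<le> C * norm x" "norm (B v - x) \<le> e / 2"
        using range_subset_image_tangent_nearby[OF x, of "e/2"] base by force
      then show "\<exists>y\<in>B ` S. dist y x < e"
        using \<open>e > 0\<close> by (intro bexI[of _ "B v"]) (auto simp: S_def dist_norm)
    qed
    ultimately show ?thesis by (auto simp: S_def closure_closed)
  qed
  then show ?thesis by blast
qed

text \<open>Given a paratingent \<open>v\<close> and a base point \<open>z\<close>, move from \<open>z\<close> so that the image under \<open>B\<close> advances by
  \<open>B v\<close>. The resulting direction is close to some paratingent \<open>u\<close>. Then \<open>B u\<close> is close to \<open>B v\<close>, and
  since \<open>u - v\<close> is again paratingent, \<open>u\<close> is close to \<open>v\<close>.\<close>

lemma strictly_smooth_if_paratingent_subspace: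
  assumes sub: "subspace (paratingent_cone \<Omega> zb)"
  shows "strictly_smooth \<Omega> zb"
proof (rule strictly_smoothI[OF base], rule subsetI)
  fix v assume v: "v \<in> paratingent_cone \<Omega> zb"
  obtain b where b: "b > 0" "\<And>x. norm (B x) \<le> b * norm x" using bound_B by blast
  show "v \<in> regular_tangent_cone \<Omega> zb"
    unfolding mem_regular_tangent_cone_iff[OF base]
  proof (intro allI impI)
    fix e :: real assume "e > 0"
    define k where "k = 1 + C * (1 + b)"
    have k: "k > 0" using b C_pos by (simp add: k_def add_pos_pos)
    define h where "h = e / (2 * k)"
    have h: "h > 0" "h * k < e" using k \<open>e > 0\<close> by (auto simp: h_def)
    obtain c where c: "c > 0" "\<forall>z\<in>\<Omega>. \<forall>t. dist z zb < c \<longrightarrow> 0 < t \<longrightarrow> t < c \<longrightarrow>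
      (\<exists>w\<in>\<Omega>. norm (w - z) \<le> C * norm (B v) * t \<and> norm (B (w - z) - t *\<^sub>R B v) \<le> h * t)"
      using reach[OF rangeI h(1)] by blast
    obtain d where d: "d > 0" "\<forall>z\<in>\<Omega>. \<forall>w\<in>\<Omega>. \<forall>t. dist z zb < d \<longrightarrow> 0 < t \<longrightarrow> t < d \<longrightarrow>
      norm (w - z) \<le> C * norm (B v) * t \<longrightarrow> (\<exists>u\<in>paratingent_cone \<Omega> zb. norm (w - z - t *\<^sub>R u) < h * t)"
      using paratingent_cone_uniform[OF h(1)] by blast
    show "\<exists>d>0. \<forall>z\<in>\<Omega>. \<forall>t. dist z zb < d \<longrightarrow> 0 < t \<longrightarrow> t < d \<longrightarrow>
            (\<exists>w\<in>\<Omega>. norm (w - z - t *\<^sub>R v) < e * t)"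
    proof (intro exI[of _ "min c d"] conjI ballI allI impI)
      fix z t assume *: "z \<in> \<Omega>" "dist z zb < min c d" "0 < t" "t < min c d"
      then obtain w where w: "w \<in> \<Omega>" "norm (w - z) \<le> C * norm (B v) * t"
          "norm (B (w - z) - t *\<^sub>R B v) \<le> h * t"
        using c(2) by auto
      then obtain u where u: "u \<in> paratingent_cone \<Omega> zb" "norm (w - z - t *\<^sub>R u) < h * t"
        using d(2)[rule_format, OF *(1) w(1) _ *(3)] *(2,4) by auto
      define r where "r = w - z - t *\<^sub>R u"
      have r: "norm r < h * t" "w - z = t *\<^sub>R u + r" using u by (auto simp: r_def)
      have "t *\<^sub>R (u - v) \<in> paratingent_cone \<Omega> zb"
        using sub u(1) v by (intro subspace_scale subspace_diff)
      then have "norm (t *\<^sub>R (u - v)) \<le> C * norm (B (t *\<^sub>R (u - v)))" by (rule paratingent_bound)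
      also have "B (t *\<^sub>R (u - v)) = (B (w - z) - t *\<^sub>R B v) - B r"
        unfolding r(2) using lin by (simp add: linear_add linear_cmul linear_diff algebra_simps)
      also have "norm \<dots> \<le> h * t + b * (h * t)"
      proof -
        have "norm (B r) \<le> b * norm r" by (rule b)
        also have "\<dots> \<le> b * (h * t)" using r b by (intro mult_left_mono) auto
        finally show ?thesis
          using w(3) norm_triangle_ineq4[of "B (w - z) - t *\<^sub>R B v" "B r"] by linarith
      qed
      finally have "norm (t *\<^sub>R (u - v)) \<le> C * (h * t + b * (h * t))" using C_pos by simp
      moreover have "w - z - t *\<^sub>R v = t *\<^sub>R (u - v) + r"
        unfolding r(2) by (simp add: algebra_simps)
      ultimately have "norm (w - z - t *\<^sub>R v) \<le> C * (h * t + b * (h * t)) + h * t"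
        using r(1) norm_triangle_ineq[of "t *\<^sub>R (u - v)" r] by simp
      also have "\<dots> = (h * k) * t" by (simp add: k_def algebra_simps)
      also have "\<dots> < e * t" using h * by (intro mult_strict_right_mono) auto
      finally show "\<exists>w\<in>\<Omega>. norm (w - z - t *\<^sub>R v) < e * t" using w(1) by blast
    qed (use c d in auto)
  qed
qed

text \<open>A paratingent \<open>v\<close> and a regular tangent \<open>u\<close> with \<open>B v = B u\<close> coincide: where \<open>v\<close> leads from \<open>z\<close>
  to \<open>w\<close>, \<open>u\<close> leads from the same \<open>z\<close> to some \<open>y\<close> of the set, and the difference of
  \<open>B w\<close> and \<open>B y\<close> is small compared with the scale, so by the expansion inequality that of \<open>w\<close> and \<open>y\<close>
  is, too.\<close>

lemma strictly_smooth_if_image_regular_tangent: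
  assumes surj: "range B \<subseteq> B ` regular_tangent_cone \<Omega> zb"
  shows "strictly_smooth \<Omega> zb"
proof (rule strictly_smoothI[OF base], rule subsetI)
  fix v assume v: "v \<in> paratingent_cone \<Omega> zb"
  obtain b where b: "b > 0" "\<And>x. norm (B x) \<le> b * norm x" using bound_B by blast
  obtain u where u: "u \<in> regular_tangent_cone \<Omega> zb" "B v = B u" using surj by blast
  obtain d where d: "d > 0" "\<forall>z\<in>\<Omega>. \<forall>w\<in>\<Omega>. dist z zb < d \<longrightarrow> dist w zb < d \<longrightarrow>
                   norm (w - z) \<le> C * norm (B (w - z))" using expand by blast
  define k where "k = 2 * (1 + C * b)"
  have k: "k > 0" using b C_pos by (simp add: k_def add_pos_pos)
  have main: "norm (v - u) \<le> h * k" if h: "h > 0" "h \<le> 1" for h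
  proof -
    obtain c where c: "c > 0" "\<forall>z\<in>\<Omega>. \<forall>t. dist z zb < c \<longrightarrow> 0 < t \<longrightarrow> t < c \<longrightarrow>
      (\<exists>w\<in>\<Omega>. norm (w - z - t *\<^sub>R u) < h * t)"
      using u(1) h(1) mem_regular_tangent_cone_iff[OF base] by blast
    \<comment> \<open>Small enough that \<open>y\<close>, at distance at most \<open>t * (norm u + 1)\<close> from \<open>z\<close>, stays in the region of the
        expansion inequality.\<close>
    define a where "a = min h (min c (min (d / 2) (d / (2 * (norm u + 1)))))"
    have a: "a > 0" "a \<le> h" "a \<le> c" "a \<le> d / 2" "a * (norm u + 1) \<le> d / 2"
    proof -
      show "a > 0" using h c d by (simp add: a_def add_nonneg_pos)
      have "a \<le> d / (2 * (norm u + 1))" by (simp add: a_def)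
      then have "a \<le> (d / 2) / (norm u + 1)" by (simp add: divide_divide_eq_left')
      then show "a * (norm u + 1) \<le> d / 2"
        by (subst (asm) pos_le_divide_eq) (auto simp: add_nonneg_pos)
      show "a \<le> d / 2"
        unfolding a_def by (rule min.coboundedI2, rule min.coboundedI2, rule min.cobounded1)
    qed (auto simp: a_def)
    obtain z w t where *: "z \<in> \<Omega>" "w \<in> \<Omega>" "dist z zb < a" "dist w zb < a" "0 < t" "t < a"
        "norm (w - z - t *\<^sub>R v) < a * t"
      using paratingent_cone_both_near[OF v a(1)] by blast
    obtain y where y: "y \<in> \<Omega>" "norm (y - z - t *\<^sub>R u) < h * t"
      using c(2) * a by (meson less_le_trans)
    have "norm (y - z) \<le> norm (t *\<^sub>R u) + norm (y - z - t *\<^sub>R u)" by (rule norm_triangle_sub)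
    also have "\<dots> \<le> t * norm u + h * t" using y(2) *(5) by simp
    also have "\<dots> \<le> t * norm u + 1 * t" using h(2) *(5) by (intro add_left_mono mult_right_mono) auto
    also have "\<dots> = t * (norm u + 1)" by (simp add: algebra_simps)
    also have "\<dots> < a * (norm u + 1)" using * by (intro mult_strict_right_mono) (auto simp: add_nonneg_pos)
    finally have "norm (y - z) < d / 2" using a by linarith
    then have "dist y zb < d" using dist_triangle[of y zb z] * a by (simp add: dist_norm)
    moreover have "dist w zb < d" using * a d(1) by linarith
    ultimately have wy: "norm (w - y) \<le> C * norm (B (w - y))" using d(2) y(1) *(2) by blast
    define r where "r = (w - z - t *\<^sub>R v) - (y - z - t *\<^sub>R u)"
    \<comment> \<open>Applying \<open>B\<close> removes the first summand, so \<open>w - y\<close> is controlled by \<open>r\<close> alone.\<close>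
    have wyr: "w - y = t *\<^sub>R (v - u) + r" by (simp add: r_def algebra_simps)
    have "a * t \<le> h * t" using a * by (intro mult_right_mono) auto
    then have nr: "norm r \<le> 2 * (h * t)"
      unfolding r_def using norm_triangle_ineq4[of "w - z - t *\<^sub>R v" "y - z - t *\<^sub>R u"] y(2) *(7) by linarith
    have "t * norm (v - u) \<le> norm (w - y) + norm r"
      using norm_triangle_ineq4[of "t *\<^sub>R (v - u) + r" r] *(5) by (simp add: wyr)
    also have "norm (w - y) + norm r \<le> C * (b * norm r) + norm r"
    proof -
      have "B (w - y) = B r"
        unfolding wyr using lin u(2) by (simp add: linear_add linear_cmul linear_diff)
      moreover have "C * norm (B r) \<le> C * (b * norm r)"
        using b C_pos by (intro mult_left_mono) auto
      ultimately show ?thesis using wy by simp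
    qed
    also have "\<dots> = (1 + C * b) * norm r" by (simp add: algebra_simps)
    also have "\<dots> \<le> (1 + C * b) * (2 * (h * t))" using nr k by (intro mult_left_mono) (auto simp: k_def)
    also have "\<dots> = t * (h * k)" by (simp add: k_def)
    finally show ?thesis using * by simp
  qed
  have "norm (v - u) \<le> 0"
  proof (rule field_le_epsilon)
    fix e :: real assume "e > 0"
    have "norm (v - u) \<le> min 1 (e / k) * k" using \<open>e > 0\<close> k by (intro main) auto
    also have "\<dots> \<le> (e / k) * k" using k by (intro mult_right_mono) auto
    finally show "norm (v - u) \<le> 0 + e" using k by simp
  qed
  then show "v \<in> regular_tangent_cone \<Omega> zb" using u by simp
qed

lemma regular_tangent_subset_paratingent_cone:
  "regular_tangent_cone \<Omega> zb \<subseteq> paratingent_cone \<Omega> zb"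
  using tangent_subset_paratingent_cone[OF base] regular_tangent_subset_tangent_cone[OF base] by order

lemma strictly_smooth_if_regular_tangent_dim:
  assumes sub: "subspace (regular_tangent_cone \<Omega> zb)"
    and dim: "dim (range B) \<le> dim (regular_tangent_cone \<Omega> zb)"
  shows "strictly_smooth \<Omega> zb"
proof (rule strictly_smooth_if_image_regular_tangent)
  have "B ` regular_tangent_cone \<Omega> zb = range B"
  proof (rule subspace_dim_equal)
    show "subspace (B ` regular_tangent_cone \<Omega> zb)" "subspace (range B)"
      using lin sub by (auto intro: linear_subspace_image)
    show "dim (range B) \<le> dim (B ` regular_tangent_cone \<Omega> zb)"
      using dim dim_image_of_subspace[OF sub regular_tangent_subset_paratingent_cone] by simp
  qed auto
  then show "range B \<subseteq> B ` regular_tangent_cone \<Omega> zb" by simp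
qed

lemma strictly_smooth_dim:
  assumes "strictly_smooth \<Omega> zb"
  shows "dim (regular_tangent_cone \<Omega> zb) = dim (range B)"
  using dim_image_of_subspace[OF strictly_smooth_cones(3)[OF base assms] regular_tangent_subset_paratingent_cone]
    image_tangent_cone strictly_smooth_cones(2)[OF base assms] by simp

text \<open>Suppose that \<open>n = adjoint B p\<close> is a limit of regular normals \<open>y\<close> at points \<open>z\<close>. At \<open>z\<close> there is a
  tangent \<open>v\<close> with \<open>B v\<close> close to \<open>p\<close>, so \<open>y \<bullet> v \<le> 0\<close> is close to \<open>n \<bullet> v = p \<bullet> B v\<close>, which is close
  to \<open>\<bar>p\<bar>\<^sup>2\<close>. For a graph this says that the limiting coderivative is trivial at \<open>0\<close>, which is
  Mordukhovich's criterion for the Lipschitz property.\<close>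

lemma limiting_normal_Int_adjoint_range:
  assumes n: "n \<in> limiting_normal_cone \<Omega> zb" "n = adjoint B p" and p: "p \<in> range B"
  shows "n = 0"
proof -
  \<comment> \<open>The error has two sources: \<open>B v\<close> differs from \<open>p\<close>, and \<open>y\<close> from \<open>n\<close>.\<close>
  have bound: "norm p ^ 2 \<le> e * (norm p + C * norm p)" if e: "e > 0" for e
  proof -
    obtain d where d: "d > 0" "\<forall>z\<in>\<Omega>. dist z zb < d \<longrightarrow>
           (\<exists>v\<in>tangent_cone \<Omega> z. norm v \<le> C * norm p \<and> norm (B v - p) \<le> e)"
      using range_subset_image_tangent_nearby[OF p e] by blast
    have "min d e > 0" using d e by simp
    then obtain z y where zy: "z \<in> \<Omega>" "dist z zb < min d e" "y \<in> regular_normal_cone \<Omega> z"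
        "dist n y < min d e"
      using n(1) unfolding mem_limiting_normal_cone_iff by blast
    then obtain v where v: "v \<in> tangent_cone \<Omega> z" "norm v \<le> C * norm p" "norm (B v - p) \<le> e"
      using d(2) by auto
    have "y \<bullet> v \<le> 0" using zy(3) v(1) by (auto simp: regular_normal_cone_def polar_cone_def)
    moreover have "n \<bullet> v = p \<bullet> B v"
      unfolding n(2) using adjoint_works[OF lin, of v p] by (simp add: inner_commute)
    moreover have "norm p ^ 2 = p \<bullet> B v - p \<bullet> (B v - p)"
      by (simp add: power2_norm_eq_inner inner_diff_right)
    moreover have "\<bar>(n - y) \<bullet> v\<bar> \<le> e * (C * norm p)"
      using zy(4) v(2) e by (intro order_trans[OF Cauchy_Schwarz_ineq2] mult_mono) (auto simp: dist_norm)
    moreover have "\<bar>p \<bullet> (B v - p)\<bar> \<le> norm p * e"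
      using v(3) by (intro order_trans[OF Cauchy_Schwarz_ineq2] mult_left_mono) auto
    ultimately show ?thesis by (simp add: inner_diff_left algebra_simps)
  qed
  have "norm p ^ 2 \<le> 0"
  proof (rule field_le_epsilon)
    fix e :: real assume "e > 0"
    define k where "k = norm p + C * norm p + 1"
    have k: "k > 0" using C_pos by (simp add: k_def add_nonneg_pos)
    have "norm p ^ 2 \<le> (e / k) * (norm p + C * norm p)" using \<open>e > 0\<close> k by (intro bound) auto
    also have "\<dots> \<le> (e / k) * k" using \<open>e > 0\<close> k by (intro mult_left_mono) (auto simp: k_def)
    finally show "norm p ^ 2 \<le> 0 + e" using k by simp
  qed
  then have "p = 0" by simp
  then show ?thesis using n(2) linear_0[OF adjoint_linear[OF lin]] by simp
qed

text \<open>The space \<open>adjoint B ` range B\<close> has the dimension of \<open>range B\<close> and meets the limiting normal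
  cone only in \<open>0\<close>.\<close>

lemma dim_limiting_normal_cone_le:
  assumes sub: "subspace (limiting_normal_cone \<Omega> zb)"
  shows "dim (limiting_normal_cone \<Omega> zb) + dim (range B) \<le> DIM('a)"
proof -
  define M where "M = adjoint B ` range B"
  have sr: "subspace (range B)" using lin by (auto intro: linear_subspace_image)
  have sM: "subspace M" unfolding M_def by (rule linear_subspace_image[OF adjoint_linear[OF lin] sr])
  have "dim M = dim (range B)"
    unfolding M_def
  proof (rule dim_image_eq[OF adjoint_linear[OF lin]])
    show "inj_on (adjoint B) (span (range B))"
    proof (rule inj_onI)
      fix x y assume "x \<in> span (range B)" "y \<in> span (range B)" and eq: "adjoint B x = adjoint B y"
      then have "x - y \<in> range B" using sr by (simp add: span_eq_iff[THEN iffD2] subspace_diff)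
      then obtain q where q: "x - y = B q" by blast
      have "adjoint B (x - y) = 0"
        using eq by (simp add: linear_diff[OF adjoint_linear[OF lin]])
      then have "(x - y) \<bullet> B q = 0"
        using adjoint_works[OF lin, of q "x - y"] by (simp add: inner_commute)
      then show "x = y" by (simp add: q[symmetric])
    qed
  qed
  moreover have "limiting_normal_cone \<Omega> zb \<inter> M \<subseteq> {0}"
    using limiting_normal_Int_adjoint_range by (auto simp: M_def)
  then have "dim (limiting_normal_cone \<Omega> zb \<inter> M) = 0" by (simp only: dim_eq_0)
  ultimately show ?thesis
    using dim_sums_Int[OF sub sM] dim_subset_UNIV[of "{x + y |x y. x \<in> limiting_normal_cone \<Omega> zb \<and> y \<in> M}"]
    by linarith
qed

text \<open>By duality the regular tangent cone is the orthogonal complement of the limiting normal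
  cone, and the bound on the dimension of the latter makes it large enough.\<close>

lemma strictly_smooth_if_limiting_normal_subspace:
  assumes sub: "subspace (limiting_normal_cone \<Omega> zb)" and clo: "locally_closed_at \<Omega> zb"
  shows "strictly_smooth \<Omega> zb"
proof -
  have "regular_tangent_cone \<Omega> zb \<subseteq> polar_cone (limiting_normal_cone \<Omega> zb)"
    using limiting_normal_subset_polar_regular_tangent_cone[OF base] by (fastforce simp: polar_cone_def inner_commute)
  then have eq: "regular_tangent_cone \<Omega> zb = orthogonal_comp (limiting_normal_cone \<Omega> zb)"
    using polar_limiting_normal_subset_regular_tangent_cone[OF base clo] polar_cone_subspace[OF sub] by order
  show ?thesis
  proof (rule strictly_smooth_if_regular_tangent_dim)
    show "subspace (regular_tangent_cone \<Omega> zb)" unfolding eq by (rule subspace_orthogonal_comp)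
    show "dim (range B) \<le> dim (regular_tangent_cone \<Omega> zb)"
      unfolding eq dim_orthogonal_comp[OF sub] using dim_limiting_normal_cone_le[OF sub] by simp
  qed
qed

text \<open>Every tangent is in the polar of the regular normal cone. If the latter is the limiting
  normal cone, then by duality every tangent is a regular tangent, and \<open>B\<close> maps the tangents
  onto its range.\<close>

lemma strictly_smooth_if_normally_regular:
  assumes reg: "normally_regular \<Omega> zb" and clo: "locally_closed_at \<Omega> zb"
  shows "strictly_smooth \<Omega> zb"
proof (rule strictly_smooth_if_image_regular_tangent)
  have "tangent_cone \<Omega> zb \<subseteq> polar_cone (regular_normal_cone \<Omega> zb)"
    by (auto simp: regular_normal_cone_def polar_cone_def inner_commute)
  also have "\<dots> \<subseteq> regular_tangent_cone \<Omega> zb"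
    using reg polar_limiting_normal_subset_regular_tangent_cone[OF base clo] by (simp add: normally_regular_def)
  finally show "range B \<subseteq> B ` regular_tangent_cone \<Omega> zb"
    using image_tangent_cone by blast
qed

end

section \<open>Coordinate projections\<close>

definition coord_proj :: "'n::finite set \<Rightarrow> real ^ 'n \<Rightarrow> real ^ 'n" where
  "coord_proj K x = (\<chi> i. if i \<in> K then x $ i else 0)"

lemma linear_coord_proj: "linear (coord_proj K)"
  by (rule linearI) (auto simp: coord_proj_def vec_eq_iff)

lemma norm_coord_proj_le: "norm (coord_proj K x) \<le> norm x"
  by (rule norm_le_componentwise_cart) (simp add: coord_proj_def)

lemma subspace_coord_space: "subspace (coord_space K)"
  by (auto simp: subspace_def coord_space_def)

lemma range_coord_proj: "range (coord_proj K) = coord_space K"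
proof -
  have "x = coord_proj K x" if "x \<in> coord_space K" for x
    using that by (auto simp: coord_proj_def coord_space_def vec_eq_iff)
  then show ?thesis by (auto simp: coord_proj_def coord_space_def)
qed

lemma diff_coord_proj_mem: "x - coord_proj K x \<in> coord_space (- K)"
  by (simp add: coord_proj_def coord_space_def)

lemma coord_proj_add:
  assumes "u \<in> coord_space K" "y \<in> coord_space (- K)"
  shows "coord_proj K (u + y) = u"
  using assms by (auto simp: coord_proj_def coord_space_def vec_eq_iff)

lemma coord_proj_eq_0_iff: "coord_proj K x = 0 \<longleftrightarrow> x \<in> coord_space (- K)"
  by (auto simp: coord_proj_def coord_space_def vec_eq_iff)

lemma dim_coord_space:
  fixes K :: "'n::finite set"
  shows "dim (coord_space K) = card K"
proof -
  have "coord_space K = {x. \<forall>i\<in>Basis. i \<notin> (\<lambda>k. axis k 1) ` K \<longrightarrow> x \<bullet> i = 0}"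
    by (auto simp: coord_space_def Basis_vec_def inner_axis axis_eq_axis)
  moreover have "dim {x::real^'n. \<forall>i\<in>Basis. i \<notin> (\<lambda>k. axis k 1) ` K \<longrightarrow> x \<bullet> i = 0}
      = card ((\<lambda>k. axis k (1::real)) ` K)"
    by (rule dim_substandard) (auto simp: Basis_vec_def)
  moreover have "card ((\<lambda>k. axis k (1::real)) ` K) = card K"
    by (intro card_image inj_onI) (simp add: axis_eq_axis)
  ultimately show ?thesis by simp
qed

text \<open>Extend a basis of \<open>V\<close> to one of the whole space by coordinate vectors; the coordinates that
  were not added form \<open>K\<close>. Writing the manifold over these coordinates allows the chart \<open>\<Phi>\<close> to be
  the identity.\<close>

lemma ex_coord_proj_inj_on_subspace:
  fixes V :: "(real ^ 'n) set"
  assumes V: "subspace V"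
  shows "\<exists>K. card K = dim V \<and> V \<inter> coord_space (- K) = {0}"
proof -
  let ?ax = "\<lambda>i::'n. axis i (1::real)"
  obtain S where S: "S \<subseteq> V" "independent S" "V \<subseteq> span S" "card S = dim V"
    using basis_exists by blast
  obtain D where D: "S \<subseteq> D" "D \<subseteq> S \<union> range ?ax" "independent D" "S \<union> range ?ax \<subseteq> span D"
    using maximal_independent_subset_extend[of S "S \<union> range ?ax"] S(2) by blast
  have "(Basis :: (real ^ 'n) set) \<subseteq> span D" using D(4) by (auto simp: Basis_vec_def)
  then have spanD: "span D = UNIV"
    by (metis span_Basis span_minimal subspace_span top.extremum_uniqueI)
  have finD: "finite D" using D(3) by (rule independent_imp_finite)
  have "card D = dim (span D)" using D(3) by (simp add: dim_eq_card_independent)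
  then have cardD: "card D = CARD('n)" by (simp add: spanD)
  define J where "J = {i. ?ax i \<in> D - S}"
  have img: "?ax ` J = D - S" using D(2) by (auto simp: J_def)
  have "card J = card (?ax ` J)" by (intro card_image[symmetric] inj_onI) (simp add: axis_eq_axis)
  also have "\<dots> = card D - card S" unfolding img
    using D(1) finD by (simp add: card_Diff_subset finite_subset)
  finally have cardJ: "card J + card S = CARD('n)"
    using cardD card_mono[OF finD D(1)] by simp
  let ?sum = "{x + y |x y. x \<in> V \<and> y \<in> coord_space J}"
  have "D \<subseteq> ?sum"
  proof
    fix x assume "x \<in> D"
    show "x \<in> ?sum"
    proof (cases "x \<in> S")
      case True
      then have "x = x + 0 \<and> x \<in> V \<and> 0 \<in> coord_space J"
        using S(1) subspace_0[OF subspace_coord_space, of J] by auto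
      then show ?thesis by blast
    next
      case False
      with \<open>x \<in> D\<close> img have "x \<in> ?ax ` J" by blast
      then have "x = 0 + x \<and> 0 \<in> V \<and> x \<in> coord_space J"
        using subspace_0[OF V] by (auto simp: coord_space_def axis_def)
      then show ?thesis by blast
    qed
  qed
  then have "span D \<subseteq> ?sum"
    by (intro span_minimal subspace_sums V subspace_coord_space)
  then have "?sum = UNIV" using spanD by blast
  then have "dim ?sum = CARD('n)" by simp
  then have "dim (V \<inter> coord_space J) = 0"
    using dim_sums_Int[OF V subspace_coord_space, of J] cardJ S(4) dim_coord_space[of J] by linarith
  then have "V \<inter> coord_space J \<subseteq> {0}" by (simp only: dim_eq_0)
  then have "V \<inter> coord_space (- (- J)) = {0}"
    using subspace_0[OF V] subspace_0[OF subspace_coord_space, of J] by auto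
  moreover have "card (- J) = dim V" using cardJ S(4) card_Diff_subset[of J UNIV] by (simp add: Compl_eq_Diff_UNIV)
  ultimately show ?thesis by blast
qed

section \<open>Strictly smooth sets are Lipschitz manifolds\<close>

text \<open>Differences of nearby points of the set are, relative to their length, close to
  paratingents.\<close>

lemma expansive_if_injective_on_paratingent_cone:
  fixes \<Omega> :: "'a::euclidean_space set" and B :: "'a \<Rightarrow> 'b::euclidean_space"
  assumes "linear B" "c > 0" and inj: "\<And>v. v \<in> paratingent_cone \<Omega> zb \<Longrightarrow> c * norm v \<le> norm (B v)"
  shows "\<exists>d>0. \<forall>z\<in>\<Omega>. \<forall>w\<in>\<Omega>. dist z zb < d \<longrightarrow> dist w zb < d \<longrightarrow>
           norm (w - z) \<le> (2 / c) * norm (B (w - z))"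
proof -
  obtain b where b: "b > 0" "\<And>x. norm (B x) \<le> b * norm x"
    using linear_bounded_pos[OF assms(1)] by blast
  \<comment> \<open>The error \<open>h\<close> is amplified by \<open>b + c\<close> and must consume at most half of \<open>c\<close>.\<close>
  define h where "h = c / (2 * (b + c))"
  have h: "h > 0" "h * (b + c) = c / 2" using b(1) assms(2) by (auto simp: h_def field_simps)
  obtain d where d: "d > 0" "\<forall>z\<in>\<Omega>. \<forall>w\<in>\<Omega>. \<forall>t. dist z zb < d \<longrightarrow> 0 < t \<longrightarrow> t < d \<longrightarrow>
      norm (w - z) \<le> 1 * t \<longrightarrow> (\<exists>v\<in>paratingent_cone \<Omega> zb. norm (w - z - t *\<^sub>R v) < h * t)"
    using paratingent_cone_uniform[OF h(1), of \<Omega> zb 1] by blast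
  show ?thesis
  proof (intro exI[of _ "d / 2"] conjI ballI impI)
    fix z w assume *: "z \<in> \<Omega>" "w \<in> \<Omega>" "dist z zb < d / 2" "dist w zb < d / 2"
    show "norm (w - z) \<le> (2 / c) * norm (B (w - z))"
    proof (cases "w = z")
      case False
      define t where "t = norm (w - z)"
      have "t < d" using * dist_triangle2[of w z zb] by (simp add: t_def dist_norm[symmetric])
      moreover have t: "t > 0" using False by (simp add: t_def)
      ultimately obtain v where v: "v \<in> paratingent_cone \<Omega> zb" "norm (w - z - t *\<^sub>R v) < h * t"
        using d(2)[rule_format, OF *(1,2), of t] * d(1) by (auto simp: t_def)
      define r where "r = w - z - t *\<^sub>R v"
      have wz: "w - z = t *\<^sub>R v + r" and r: "norm r \<le> h * t" using v by (auto simp: r_def)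
      have "c * t \<le> c * (norm (t *\<^sub>R v) + norm r)"
        unfolding t_def using assms(2) wz norm_triangle_ineq[of "t *\<^sub>R v" r] by (simp add: t_def)
      also have "\<dots> = t * (c * norm v) + c * norm r" using t by (simp add: algebra_simps)
      also have "\<dots> \<le> t * norm (B v) + c * norm r"
        using inj[OF v(1)] t by simp
      also have "t * norm (B v) = norm (B (w - z) - B r)"
        unfolding wz using assms(1) t by (simp add: linear_add linear_cmul)
      also have "\<dots> \<le> norm (B (w - z)) + b * norm r"
        using norm_triangle_ineq4[of "B (w - z)" "B r"] b(2)[of r] by linarith
      finally have "c * t \<le> norm (B (w - z)) + (b + c) * norm r" by (simp add: algebra_simps)
      also have "(b + c) * norm r \<le> (b + c) * (h * t)" using r b assms(2) by (intro mult_left_mono) auto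
      also have "(b + c) * (h * t) = c / 2 * t" unfolding h(2)[symmetric] by (simp add: algebra_simps)
      finally have "c / 2 * t \<le> norm (B (w - z))" by simp
      then show ?thesis using assms(2) by (simp add: t_def field_simps)
    qed (use linear_0[OF assms(1)] in simp)
  qed (use d in simp)
qed

text \<open>Take a point \<open>z\<close> of the set near \<open>zb\<close> whose image is as close as possible to \<open>u\<close>. The
  expansion inequality keeps \<open>z\<close> in the interior of the ball, so if \<open>B z \<noteq> u\<close>, one could advance in
  the direction of \<open>u - B z\<close> and come closer. Local closedness enters here, for the existence of \<open>z\<close>.\<close>

lemma projection_covers_neighborhood:
  fixes \<Omega> :: "'a::euclidean_space set" and B :: "'a \<Rightarrow> 'b::euclidean_space"
  assumes base: "zb \<in> \<Omega>" and lin: "linear B" and "C > 0"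
    and contr: "\<And>x. norm (B x) \<le> norm x"
    and clo: "closed (\<Omega> \<inter> cball zb R)"
    and expand: "\<And>z. z \<in> \<Omega> \<Longrightarrow> dist z zb \<le> R \<Longrightarrow> dist z zb \<le> C * norm (B z - B zb)"
    and advance: "\<And>z x e. z \<in> \<Omega> \<Longrightarrow> dist z zb < R \<Longrightarrow> x \<in> range B \<Longrightarrow> norm x = 1 \<Longrightarrow> e > 0 \<Longrightarrow>
       \<exists>w\<in>\<Omega>. \<exists>t. 0 < t \<and> t < e \<and> norm (w - z) < e \<and> norm (B (w - z) - t *\<^sub>R x) < t"
    and u: "u \<in> range B" "2 * C * norm (u - B zb) < R"
  shows "\<exists>z\<in>\<Omega>. dist z zb < R \<and> B z = u"
proof -
  define A where "A = \<Omega> \<inter> cball zb R"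
  have "0 \<le> 2 * C * norm (u - B zb)" using \<open>C > 0\<close> by simp
  then have zbA: "zb \<in> A" using base u(2) by (simp add: A_def)
  have "compact A" using clo compact_Int_closed[OF compact_cball clo, of zb R]
    by (simp add: A_def Int_ac)
  moreover have "continuous_on A (\<lambda>z. norm (u - B z))"
    using lin by (intro continuous_intros linear_continuous_on) (simp add: linear_conv_bounded_linear)
  ultimately obtain z where z: "z \<in> A" "\<And>w. w \<in> A \<Longrightarrow> norm (u - B z) \<le> norm (u - B w)"
    using continuous_attains_inf[of A "\<lambda>z. norm (u - B z)"] zbA by blast
  have "norm (B z - B zb) \<le> 2 * norm (u - B zb)"
    using z(2)[OF zbA] norm_triangle_ineq4[of "u - B zb" "u - B z"] by simp
  then have "C * norm (B z - B zb) \<le> C * (2 * norm (u - B zb))" using \<open>C > 0\<close> by simp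
  moreover have "dist z zb \<le> C * norm (B z - B zb)"
    using z(1) by (intro expand) (auto simp: A_def dist_commute)
  ultimately have near: "dist z zb < R" using u(2) by linarith
  have "B z = u"
  proof (rule ccontr)
    assume "B z \<noteq> u"
    define q where "q = norm (u - B z)"
    have q: "q > 0" using \<open>B z \<noteq> u\<close> by (simp add: q_def)
    define x where "x = (u - B z) /\<^sub>R q"
    have "u - B z \<in> range B" using u(1) lin by (auto simp: linear_diff[symmetric])
    then have "x \<in> range B" unfolding x_def using lin by (auto simp: linear_cmul[symmetric])
    moreover have "norm x = 1" using q by (simp add: x_def q_def)
    moreover have "min q (R - dist z zb) > 0" using q near by simp
    ultimately obtain w t where w: "w \<in> \<Omega>" "0 < t" "t < q" "norm (w - z) < R - dist z zb"
      "norm (B (w - z) - t *\<^sub>R x) < t"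
      using advance[of z x "min q (R - dist z zb)"] z(1) near by (auto simp: A_def)
    have "w \<in> A"
      using w dist_triangle[of w zb z] by (simp add: A_def dist_norm norm_minus_commute[of zb w])
    then have "q \<le> norm (u - B w)" unfolding q_def by (rule z(2))
    also have "u - B w = (q - t) *\<^sub>R x - (B (w - z) - t *\<^sub>R x)"
    proof -
      have "u - B z = q *\<^sub>R x" using q by (simp add: x_def)
      then have "u = B z + q *\<^sub>R x" by (simp add: algebra_simps)
      then show ?thesis using lin by (simp add: linear_diff algebra_simps)
    qed
    also have "norm \<dots> \<le> norm ((q - t) *\<^sub>R x) + norm (B (w - z) - t *\<^sub>R x)" by (rule norm_triangle_ineq4)
    also have "\<dots> < (q - t) + t" using w \<open>norm x = 1\<close> by simp
    finally show False by simp
  qed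
  then show ?thesis using near z(1) by (auto simp: A_def)
qed

text \<open>The chart is the identity, and \<open>f\<close> maps the projection of a point of the manifold to the
  remaining coordinates of this point.\<close>

lemma lipschitz_manifold_dimI:
  fixes \<Omega> :: "(real ^ 'n) set"
  assumes W: "open W" "zb \<in> W" and U: "open U"
    and img: "coord_proj K ` (\<Omega> \<inter> W) = coord_space K \<inter> U"
    and expand: "\<And>z w. z \<in> \<Omega> \<inter> W \<Longrightarrow> w \<in> \<Omega> \<inter> W \<Longrightarrow>
                   norm (w - z) \<le> C * norm (coord_proj K (w - z))"
    and "C > 0"
  shows "lipschitz_manifold_dim (card K) \<Omega> zb"
proof -
  let ?P = "coord_proj K" and ?M = "\<Omega> \<inter> W"
  have inj: "inj_on ?P ?M"
  proof (rule inj_onI)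
    fix z w assume "z \<in> ?M" "w \<in> ?M" "?P z = ?P w"
    then show "z = w" using expand[of z w] by (simp add: linear_diff[OF linear_coord_proj])
  qed
  define g where "g = inv_into ?M ?P"
  define f where "f u = g u - u" for u
  have g: "g u \<in> ?M" "?P (g u) = u" if "u \<in> ?P ` ?M" for u
    unfolding g_def using that by (fact inv_into_into, intro f_inv_into_f)
  have gP: "g (?P z) = z" if "z \<in> ?M" for z using inj that by (simp add: g_def)
  have "f ` (?P ` ?M) \<subseteq> coord_space (- K)"
  proof (rule image_subsetI)
    fix u assume "u \<in> ?P ` ?M"
    then show "f u \<in> coord_space (- K)"
      using diff_coord_proj_mem[of "g u" K] g(2) by (simp add: f_def)
  qed
  moreover have "(C + 1)-lipschitz_on (?P ` ?M) f"
  proof (rule lipschitz_onI)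
    fix u v assume uv: "u \<in> ?P ` ?M" "v \<in> ?P ` ?M"
    have "norm (g u - g v) \<le> C * norm (?P (g u - g v))" using g uv by (intro expand) auto
    also have "?P (g u - g v) = u - v" using g(2) uv by (simp add: linear_diff[OF linear_coord_proj])
    finally have "norm (g u - g v) \<le> C * norm (u - v)" .
    moreover have "f u - f v = (g u - g v) - (u - v)" by (simp add: f_def)
    moreover have "norm (f u - f v) \<le> norm (g u - g v) + norm (u - v)"
      unfolding \<open>f u - f v = _\<close> by (rule norm_triangle_ineq4)
    ultimately have "norm (f u - f v) \<le> C * norm (u - v) + norm (u - v)" by linarith
    then show "dist (f u) (f v) \<le> (C + 1) * dist u v" by (simp add: dist_norm distrib_right)
  qed (use \<open>C > 0\<close> in simp)
  moreover have "id ` ?M = (\<lambda>u. u + f u) ` (?P ` ?M)"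
    using gP by (force simp: f_def image_image)
  moreover have "continuously_differentiable_on id W"
    unfolding continuously_differentiable_on_def
    by (intro exI[of _ "\<lambda>x. id_blinfun"]) (simp_all add: id_def)
  moreover have "continuously_differentiable_on (inv_into W id) (id ` W)"
    unfolding continuously_differentiable_on_def
  proof (intro exI[of _ "\<lambda>x. id_blinfun"] conjI ballI)
    fix x assume "x \<in> id ` W"
    then have "x \<in> W" by simp
    have "(inv_into W id has_derivative (\<lambda>x. x)) (at x)"
    proof (rule has_derivative_transform_within_open[OF has_derivative_ident W(1) \<open>x \<in> W\<close>])
      fix y assume "y \<in> W"
      then show "y = inv_into W id y" using inv_into_f_f[OF inj_on_id, of y W] by simp
    qed
    then show "(inv_into W id has_derivative blinfun_apply id_blinfun) (at x)" by simp
  qed simp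
  moreover have "openin (top_of_set (coord_space K)) (?P ` ?M)"
    unfolding img using U by (rule openin_open_Int)
  moreover have "inj_on id W" "open (id ` W)" using W by auto
  ultimately show ?thesis
    unfolding lipschitz_manifold_dim_def using W
    by (intro exI[of _ W] exI[of _ id] exI[of _ K] exI[of _ "?P ` ?M"] exI[of _ f] exI[of _ "C + 1"]) simp
qed

text \<open>With \<open>V\<close> the common value of the cones and \<open>P\<close> a coordinate projection injective on \<open>V\<close>, the
  paratingent half of strict smoothness makes the set locally a Lipschitz graph over its image under
  \<open>P\<close>, and the regular tangent half makes this image a neighbourhood of \<open>P zb\<close>.\<close>

lemma strictly_smooth_imp_lipschitz_manifold_dim:
  fixes \<Omega> :: "(real ^ 'n) set"
  assumes base: "zb \<in> \<Omega>" and clo: "locally_closed_at \<Omega> zb" and smooth: "strictly_smooth \<Omega> zb"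
  shows "lipschitz_manifold_dim (dim (regular_tangent_cone \<Omega> zb)) \<Omega> zb"
proof -
  define V where "V = regular_tangent_cone \<Omega> zb"
  have V: "subspace V" "paratingent_cone \<Omega> zb = V"
    using strictly_smooth_cones[OF base smooth] by (auto simp: V_def)
  obtain K where K: "card K = dim V" "V \<inter> coord_space (- K) = {0}"
    using ex_coord_proj_inj_on_subspace[OF V(1)] by blast
  let ?P = "coord_proj K"
  note lin = linear_coord_proj[of K]
  have "bounded_linear ?P" using lin by (simp add: linear_conv_bounded_linear)
  then have "\<exists>c>0. \<forall>v\<in>V. c * norm v \<le> norm (?P v)"
    using injective_imp_isometric[OF closed_subspace[OF V(1)] V(1), of ?P] K(2)
    by (auto simp: coord_proj_eq_0_iff mult.commute)
  then obtain c where c: "c > 0" "\<And>v. v \<in> V \<Longrightarrow> c * norm v \<le> norm (?P v)" by blast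
  define C where "C = 2 / c"
  have C: "C > 0" using c by (simp add: C_def)
  obtain d where d: "d > 0" "\<And>z w. z \<in> \<Omega> \<Longrightarrow> w \<in> \<Omega> \<Longrightarrow> dist z zb < d \<Longrightarrow> dist w zb < d \<Longrightarrow>
      norm (w - z) \<le> C * norm (?P (w - z))"
    using expansive_if_injective_on_paratingent_cone[OF lin c(1), of \<Omega> zb] c(2) V(2)
    unfolding C_def by blast
  have "dim (?P ` V) = dim V"
  proof (rule dim_image_eq[OF lin])
    show "inj_on ?P (span V)"
    proof (rule inj_onI)
      fix x y assume "x \<in> span V" "y \<in> span V" "?P x = ?P y"
      then have "x - y \<in> V" "?P (x - y) = 0"
        using V(1) by (auto simp: span_eq_iff[THEN iffD2] subspace_diff linear_diff[OF lin])
      then have "x - y \<in> V \<inter> coord_space (- K)" by (simp add: coord_proj_eq_0_iff)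
      then show "x = y" unfolding K(2) by simp
    qed
  qed
  then have PV: "?P ` V = coord_space K"
    using linear_subspace_image[OF lin V(1)] subspace_coord_space range_coord_proj[of K] K(1)
    by (intro subspace_dim_equal) (auto simp: dim_coord_space)
  \<comment> \<open>Contains the preimages in \<open>V\<close> of all unit vectors of the coordinate space.\<close>
  define S where "S = V \<inter> cball 0 (1 / c)"
  have "compact S" unfolding S_def
    using compact_Int_closed[OF compact_cball closed_subspace[OF V(1)]] by (simp add: Int_commute)
  moreover have "S \<subseteq> regular_tangent_cone \<Omega> zb" by (auto simp: S_def V_def)
  ultimately obtain d' where d': "d' > 0" "\<forall>z\<in>\<Omega>. \<forall>t. dist z zb < d' \<longrightarrow> 0 < t \<longrightarrow> t < d' \<longrightarrow>
           (\<forall>v\<in>S. \<exists>w\<in>\<Omega>. norm (w - z - t *\<^sub>R v) < 1 * t)"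
    using regular_tangent_cone_uniform[OF base _ _ zero_less_one] by blast
  obtain r where r: "r > 0" "closed (\<Omega> \<inter> cball zb r)"
    using locally_closed_at_imp_closed_Int_cball[OF clo] .
  define R where "R = min r (min d d') / 2"
  have R: "R > 0" "R < d" "R < d'" "R \<le> r" using r d d' by (auto simp: R_def)
  have covers: "\<exists>z\<in>\<Omega>. dist z zb < R \<and> ?P z = u"
    if u: "u \<in> coord_space K" "2 * C * norm (u - ?P zb) < R" for u
  proof (rule projection_covers_neighborhood[OF base lin C norm_coord_proj_le])
    have "\<Omega> \<inter> cball zb R = (\<Omega> \<inter> cball zb r) \<inter> cball zb R" using R by auto
    then show "closed (\<Omega> \<inter> cball zb R)" using r(2) by (metis closed_Int closed_cball)
    show "dist z zb \<le> C * norm (?P z - ?P zb)" if "z \<in> \<Omega>" "dist z zb \<le> R" for z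
      using d(2)[OF base that(1)] that(2) R d(1) by (simp add: dist_norm linear_diff[OF lin])
    show "\<exists>w\<in>\<Omega>. \<exists>t. 0 < t \<and> t < e \<and> norm (w - z) < e \<and> norm (?P (w - z) - t *\<^sub>R x) < t"
      if z: "z \<in> \<Omega>" "dist z zb < R" and x: "x \<in> range ?P" "norm x = 1" and e: "e > 0" for z x e
    proof -
      obtain v where v: "v \<in> V" "?P v = x" using x(1)[unfolded range_coord_proj PV[symmetric]] by blast
      then have "norm v \<le> 1 / c" using c(2)[OF v(1)] c(1) x(2) by (simp add: field_simps)
      then have "v \<in> S" using v(1) by (simp add: S_def)
      define k where "k = norm v + 1"
      have k: "k \<ge> 1" by (simp add: k_def)
      define m where "m = min d' (e / k)"
      have m: "m > 0" "m \<le> d'" "m * k \<le> e"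
        using d' e k by (auto simp: m_def pos_le_divide_eq[symmetric])
      have "m * 1 \<le> m * k" using m k by (intro mult_left_mono) auto
      with m have "m \<le> e" by linarith
      obtain t where t: "0 < t" "t < m" using m(1) dense by blast
      then obtain w where w: "w \<in> \<Omega>" "norm (w - z - t *\<^sub>R v) < 1 * t"
        using d'(2)[rule_format, OF z(1) _ _ _ \<open>v \<in> S\<close>, of t] z(2) R m by auto
      have "norm (w - z) \<le> norm (t *\<^sub>R v) + norm (w - z - t *\<^sub>R v)" by (rule norm_triangle_sub)
      also have "\<dots> \<le> t * k" using w(2) t by (simp add: k_def algebra_simps)
      also have "\<dots> < m * k" using t k by (intro mult_strict_right_mono) auto
      finally have "norm (w - z) < e" using m by linarith
      moreover have "?P (w - z) - t *\<^sub>R x = ?P (w - z - t *\<^sub>R v)"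
        using lin v(2) by (simp add: linear_diff linear_cmul)
      then have "norm (?P (w - z) - t *\<^sub>R x) < t"
        using norm_coord_proj_le[of K "w - z - t *\<^sub>R v"] w(2) by simp
      ultimately show ?thesis using w(1) t \<open>m \<le> e\<close> by (intro bexI[of _ w] exI[of _ t]) auto
    qed
    show "u \<in> range ?P" "2 * C * norm (u - ?P zb) < R" using u by (simp_all add: range_coord_proj)
  qed
  define U where "U = {u. 2 * C * norm (u - ?P zb) < R}"
  define W where "W = ball zb R \<inter> ?P -` U"
  have "open U" unfolding U_def by (intro open_Collect_less continuous_intros)
  moreover have "open (?P -` U)"
    using \<open>open U\<close> lin by (intro open_vimage linear_continuous_on) (auto simp: linear_conv_bounded_linear)
  then have "open W" unfolding W_def by blast
  moreover have "zb \<in> W" using R by (simp add: W_def U_def)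
  moreover have "?P ` (\<Omega> \<inter> W) = coord_space K \<inter> U"
  proof
    show "?P ` (\<Omega> \<inter> W) \<subseteq> coord_space K \<inter> U" using range_coord_proj[of K] by (auto simp: W_def)
    show "coord_space K \<inter> U \<subseteq> ?P ` (\<Omega> \<inter> W)"
    proof
      fix u assume u: "u \<in> coord_space K \<inter> U"
      then obtain z where "z \<in> \<Omega>" "dist z zb < R" "?P z = u" using covers by (auto simp: U_def)
      with u show "u \<in> ?P ` (\<Omega> \<inter> W)" by (auto simp: W_def dist_commute)
    qed
  qed
  moreover have "norm (w - z) \<le> C * norm (?P (w - z))" if "z \<in> \<Omega> \<inter> W" "w \<in> \<Omega> \<inter> W" for z w
    using that R by (intro d(2)) (auto simp: W_def dist_commute)
  ultimately have "lipschitz_manifold_dim (card K) \<Omega> zb"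
    using C by (intro lipschitz_manifold_dimI) auto
  then show ?thesis using K(1) by (simp add: V_def)
qed

section \<open>Lipschitz manifolds have linear charts\<close>

text \<open>The mean value inequality for \<open>g\<close> minus its derivative at \<open>x0\<close>.\<close>

lemma continuously_differentiable_imp_strictly_differentiable:
  fixes g :: "'a::real_normed_vector \<Rightarrow> 'b::real_normed_vector"
  assumes cd: "continuously_differentiable_on g S" and "open S" "x0 \<in> S"
  obtains A where "(g has_derivative A) (at x0)"
    "\<And>e. e > 0 \<Longrightarrow> \<exists>d>0. ball x0 d \<subseteq> S \<and>
       (\<forall>x\<in>ball x0 d. \<forall>y\<in>ball x0 d. norm (g y - g x - A (y - x)) \<le> e * norm (y - x))"
proof -
  obtain g' :: "'a \<Rightarrow> 'a \<Rightarrow>\<^sub>L 'b" where g': "continuous_on S g'"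
    "\<And>x. x \<in> S \<Longrightarrow> (g has_derivative blinfun_apply (g' x)) (at x)"
    using cd unfolding continuously_differentiable_on_def by blast
  show thesis
  proof (rule that[of "blinfun_apply (g' x0)"])
    show "(g has_derivative blinfun_apply (g' x0)) (at x0)" using g'(2) assms(3) .
    fix e :: real assume e: "e > 0"
    obtain c where c: "c > 0" "\<And>x. x \<in> S \<Longrightarrow> dist x x0 < c \<Longrightarrow> dist (g' x) (g' x0) < e"
      using g'(1) assms(3) e unfolding continuous_on_iff by metis
    obtain b where b: "b > 0" "ball x0 b \<subseteq> S" using assms(2,3) open_contains_ball by metis
    define d where "d = min b c"
    have sub: "ball x0 d \<subseteq> S" using b by (auto simp: d_def)
    have "norm (g y - g x - blinfun_apply (g' x0) (y - x)) \<le> e * norm (y - x)"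
      if xy: "x \<in> ball x0 d" "y \<in> ball x0 d" for x y
    proof -
      have "norm ((g y - g' x0 y) - (g x - g' x0 x)) \<le> e * norm (y - x)"
      proof (rule differentiable_bound[OF convex_ball _ _ xy(2,1)])
        fix u assume u: "u \<in> ball x0 d"
        then have "u \<in> S" using sub by blast
        then show "((\<lambda>x. g x - g' x0 x) has_derivative blinfun_apply (g' u - g' x0)) (at u within ball x0 d)"
          by (auto intro!: derivative_eq_intros has_derivative_at_withinI[OF g'(2)] simp: blinfun.diff_left)
        show "onorm (blinfun_apply (g' u - g' x0)) \<le> e"
          using c(2)[OF \<open>u \<in> S\<close>] u by (simp add: norm_blinfun.rep_eq[symmetric] dist_norm d_def norm_minus_commute)
      qed
      then show ?thesis by (simp add: blinfun.diff_right algebra_simps)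
    qed
    then show "\<exists>d>0. ball x0 d \<subseteq> S \<and>
       (\<forall>x\<in>ball x0 d. \<forall>y\<in>ball x0 d. norm (g y - g x - g' x0 (y - x)) \<le> e * norm (y - x))"
      using sub b(1) c(1) by (intro exI[of _ d]) (auto simp: d_def)
  qed
qed

text \<open>With \<open>A\<close> the derivative of \<open>\<Phi>\<close> at \<open>zb\<close> and \<open>P\<close> the projection onto the parameter space, take
  \<open>B = P \<circ> A\<close>. Strict differentiability of \<open>\<Phi>\<close> makes \<open>B (w - z)\<close> agree with the difference of the
  parameters of \<open>w\<close> and \<open>z\<close> up to a small multiple of \<open>\<bar>w - z\<bar>\<close>; strict differentiability of the
  inverse bounds \<open>\<bar>w - z\<bar>\<close> by the distance of the images on the graph, hence by that of
  the parameters.\<close>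

lemma lipschitz_manifold_imp_linear_chart:
  fixes \<Omega> :: "(real ^ 'n) set"
  assumes man: "lipschitz_manifold_dim d \<Omega> zb" and base: "zb \<in> \<Omega>"
  shows "\<exists>(B :: real ^ 'n \<Rightarrow> real ^ 'n) C. linear_chart \<Omega> zb B C \<and> dim (range B) = d"
proof -
  obtain W K U f L and \<Phi> :: "real ^ 'n \<Rightarrow> real ^ 'n"
    where W: "open W" "zb \<in> W" "inj_on \<Phi> W" "open (\<Phi> ` W)"
      and cd: "continuously_differentiable_on \<Phi> W" "continuously_differentiable_on (inv_into W \<Phi>) (\<Phi> ` W)"
      and K: "card K = d" and U: "openin (top_of_set (coord_space K)) U"
      and f: "f ` U \<subseteq> coord_space (- K)" "L-lipschitz_on U f"
      and img: "\<Phi> ` (\<Omega> \<inter> W) = (\<lambda>u. u + f u) ` U"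
    using man unfolding lipschitz_manifold_dim_def by auto
  let ?P = "coord_proj K" and ?\<Psi> = "inv_into W \<Phi>"
  note linP = linear_coord_proj[of K]
  have \<Psi>\<Phi>: "?\<Psi> (\<Phi> z) = z" if "z \<in> W" for z using W(3) that by simp
  have L: "L \<ge> 0" using f(2) by (rule lipschitz_on_nonneg)
  have U_sub: "U \<subseteq> coord_space K" using U by (rule openin_imp_subset)
  have Pf: "?P (u + f u) = u" if "u \<in> U" for u
    using that U_sub f(1) by (intro coord_proj_add) auto
  have graph: "?P (\<Phi> z) \<in> U" "\<Phi> z = ?P (\<Phi> z) + f (?P (\<Phi> z))" if z: "z \<in> \<Omega> \<inter> W" for z
  proof -
    obtain u where "u \<in> U" "\<Phi> z = u + f u" using z img by blast
    then show "?P (\<Phi> z) \<in> U" "\<Phi> z = ?P (\<Phi> z) + f (?P (\<Phi> z))" using Pf by auto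
  qed
  have graph_lip: "norm ((u + f u) - (v + f v)) \<le> (1 + L) * norm (u - v)" if "u \<in> U" "v \<in> U" for u v
  proof -
    have "(u + f u) - (v + f v) = (u - v) + (f u - f v)" by simp
    also have "norm \<dots> \<le> norm (u - v) + norm (f u - f v)" by (rule norm_triangle_ineq)
    also have "\<dots> \<le> (1 + L) * norm (u - v)"
      using lipschitz_onD[OF f(2) that] by (simp add: dist_norm distrib_right)
    finally show ?thesis .
  qed
  obtain A where A: "(\<Phi> has_derivative A) (at zb)"
    "\<And>e. e > 0 \<Longrightarrow> \<exists>d>0. ball zb d \<subseteq> W \<and>
       (\<forall>x\<in>ball zb d. \<forall>y\<in>ball zb d. norm (\<Phi> y - \<Phi> x - A (y - x)) \<le> e * norm (y - x))"
    using continuously_differentiable_imp_strictly_differentiable[OF cd(1) W(1,2)] by blast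
  obtain A' where A': "(?\<Psi> has_derivative A') (at (\<Phi> zb))"
    "\<And>e. e > 0 \<Longrightarrow> \<exists>d>0. ball (\<Phi> zb) d \<subseteq> \<Phi> ` W \<and>
       (\<forall>x\<in>ball (\<Phi> zb) d. \<forall>y\<in>ball (\<Phi> zb) d. norm (?\<Psi> y - ?\<Psi> x - A' (y - x)) \<le> e * norm (y - x))"
    using continuously_differentiable_imp_strictly_differentiable[OF cd(2) W(4) imageI[OF W(2)]] by blast
  have linA: "linear A" using A(1) by (rule has_derivative_linear)
  have "(?\<Psi> \<circ> \<Phi> has_derivative A' \<circ> A) (at zb)" using A(1) A'(1) by (rule diff_chain_at)
  moreover have "(?\<Psi> \<circ> \<Phi> has_derivative (\<lambda>x. x)) (at zb)"
    by (rule has_derivative_transform_within_open[OF has_derivative_ident W(1,2)]) (simp add: \<Psi>\<Phi>)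
  ultimately have "A' \<circ> A = (\<lambda>x. x)" by (rule has_derivative_unique)
  then have "inj A" by (metis inj_on_id2 inj_on_imageI2)
  then have surjA: "surj A" using linear_injective_imp_surjective[OF linA _ refl] by blast
  define B where "B x = ?P (A x)" for x
  have linB: "linear B" using linear_compose[OF linA linP] by (simp add: B_def[abs_def] o_def)
  \<comment> \<open>The inverse of \<open>\<Phi>\<close> is differentiable, so \<open>A\<close> is invertible and \<open>B\<close> has the range of \<open>P\<close>.\<close>
  have rangeB: "range B = coord_space K"
  proof -
    have "range B = ?P ` range A" by (auto simp: B_def)
    then show ?thesis by (simp add: surjA range_coord_proj)
  qed
  have B_approx: "norm (B (w - z) - ?P (\<Phi> w - \<Phi> z)) \<le> norm (\<Phi> w - \<Phi> z - A (w - z))" for w z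
  proof -
    have "?P (\<Phi> w - \<Phi> z) - B (w - z) = ?P (\<Phi> w - \<Phi> z - A (w - z))"
      by (simp add: B_def linear_diff[OF linP])
    then show ?thesis using norm_coord_proj_le[of K "\<Phi> w - \<Phi> z - A (w - z)"]
      by (metis norm_minus_commute)
  qed
  obtain b where b: "b > 0" "\<And>x. norm (A' x) \<le> b * norm x"
    using linear_bounded_pos[OF has_derivative_linear[OF A'(1)]] by blast
  obtain \<delta> where \<delta>: "\<delta> > 0" "ball (\<Phi> zb) \<delta> \<subseteq> \<Phi> ` W"
    "\<And>x y. x \<in> ball (\<Phi> zb) \<delta> \<Longrightarrow> y \<in> ball (\<Phi> zb) \<delta> \<Longrightarrow>
       norm (?\<Psi> y - ?\<Psi> x - A' (y - x)) \<le> 1 * norm (y - x)"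
    using A'(2)[OF zero_less_one] by blast
  have \<Psi>_lip: "norm (w - z) \<le> (b + 1) * norm (\<Phi> w - \<Phi> z)"
    if "w \<in> W" "z \<in> W" "\<Phi> w \<in> ball (\<Phi> zb) \<delta>" "\<Phi> z \<in> ball (\<Phi> zb) \<delta>" for w z
  proof -
    have "norm (?\<Psi> (\<Phi> w) - ?\<Psi> (\<Phi> z)) \<le> norm (A' (\<Phi> w - \<Phi> z)) + 1 * norm (\<Phi> w - \<Phi> z)"
      using \<delta>(3)[OF that(4,3)] norm_triangle_sub[of "?\<Psi> (\<Phi> w) - ?\<Psi> (\<Phi> z)" "A' (\<Phi> w - \<Phi> z)"]
      by linarith
    then show ?thesis using b(2)[of "\<Phi> w - \<Phi> z"] that by (simp add: \<Psi>\<Phi> distrib_right)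
  qed
  define C where "C = (b + 1) * (1 + L)"
  have C: "C > 0" using b L by (simp add: C_def)
  have near_lip: "norm (w - z) \<le> C * norm (?P (\<Phi> w - \<Phi> z))"
    if "w \<in> \<Omega> \<inter> W" "z \<in> \<Omega> \<inter> W" "\<Phi> w \<in> ball (\<Phi> zb) \<delta>" "\<Phi> z \<in> ball (\<Phi> zb) \<delta>" for w z
  proof -
    have "norm (w - z) \<le> (b + 1) * norm (\<Phi> w - \<Phi> z)" using that by (intro \<Psi>_lip) auto
    also have "norm (\<Phi> w - \<Phi> z) \<le> (1 + L) * norm (?P (\<Phi> w) - ?P (\<Phi> z))"
      using graph_lip[OF graph(1)[OF that(1)] graph(1)[OF that(2)]]
      by (simp only: graph(2)[OF that(1), symmetric] graph(2)[OF that(2), symmetric])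
    also have "?P (\<Phi> w) - ?P (\<Phi> z) = ?P (\<Phi> w - \<Phi> z)" by (simp add: linear_diff[OF linP])
    finally show ?thesis using b by (simp add: C_def mult.assoc)
  qed
  have cont: "\<exists>d>0. \<forall>z. dist z zb < d \<longrightarrow> dist (\<Phi> z) (\<Phi> zb) < e" if "e > 0" for e
    using has_derivative_continuous[OF A(1)] that unfolding continuous_at_eps_delta by blast
  have "linear_chart \<Omega> zb B (2 * C)"
  proof (rule linear_chart.intro)
    show "zb \<in> \<Omega>" "linear B" "0 < 2 * C" using base linB C by auto
    \<comment> \<open>With this tolerance the error term is at most half of \<open>norm (w - z)\<close> and can be absorbed, which
        doubles the constant.\<close>
    have half: "1 / (2 * C) > 0" using C by simp
    obtain c where c: "c > 0" "ball zb c \<subseteq> W"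
      "\<And>x y. x \<in> ball zb c \<Longrightarrow> y \<in> ball zb c \<Longrightarrow> norm (\<Phi> y - \<Phi> x - A (y - x)) \<le> 1 / (2 * C) * norm (y - x)"
      using A(2)[OF half] by blast
    obtain c' where c': "c' > 0" "\<And>z. dist z zb < c' \<Longrightarrow> dist (\<Phi> z) (\<Phi> zb) < \<delta>"
      using cont[OF \<delta>(1)] by blast
    show "\<exists>d>0. \<forall>z\<in>\<Omega>. \<forall>w\<in>\<Omega>. dist z zb < d \<longrightarrow> dist w zb < d \<longrightarrow>
            norm (w - z) \<le> 2 * C * norm (B (w - z))"
    proof (intro exI[of _ "min c c'"] conjI ballI impI)
      fix z w assume *: "z \<in> \<Omega>" "w \<in> \<Omega>" "dist z zb < min c c'" "dist w zb < min c c'"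
      then have zw: "z \<in> ball zb c" "w \<in> ball zb c" by (auto simp: dist_commute)
      then have "norm (w - z) \<le> C * norm (?P (\<Phi> w - \<Phi> z))"
        using * c(2) c'(2) by (intro near_lip) (auto simp: dist_commute)
      also have "norm (?P (\<Phi> w - \<Phi> z)) \<le> norm (B (w - z)) + 1 / (2 * C) * norm (w - z)"
        using B_approx[of w z] c(3)[OF zw]
          norm_triangle_sub[of "?P (\<Phi> w - \<Phi> z)" "B (w - z)"]
          norm_minus_commute[of "?P (\<Phi> w - \<Phi> z)" "B (w - z)"] by linarith
      finally have "norm (w - z) \<le> C * (norm (B (w - z)) + 1 / (2 * C) * norm (w - z))"
        using C by simp
      also have "\<dots> = C * norm (B (w - z)) + norm (w - z) / 2" using C by (simp add: distrib_left)
      finally show "norm (w - z) \<le> 2 * C * norm (B (w - z))" by simp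
    qed (use c c' in auto)
  next
    fix x and e :: real assume x: "x \<in> range B" and e: "e > 0"
    define h where "h = e / (C * norm x + 1)"
    have Cx: "C * norm x \<ge> 0" using C by simp
    have h: "h > 0" "h * (C * norm x) \<le> e"
    proof -
      show "h > 0" using e Cx by (simp add: h_def add_nonneg_pos)
      have "h * (C * norm x) \<le> h * (C * norm x + 1)" using \<open>h > 0\<close> by (intro mult_left_mono) auto
      also have "\<dots> = e" using Cx by (simp add: h_def)
      finally show "h * (C * norm x) \<le> e" .
    qed
    obtain c where c: "c > 0" "ball zb c \<subseteq> W"
      "\<And>x y. x \<in> ball zb c \<Longrightarrow> y \<in> ball zb c \<Longrightarrow> norm (\<Phi> y - \<Phi> x - A (y - x)) \<le> h * norm (y - x)"
      using A(2)[OF h(1)] by blast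
    define u0 where "u0 = ?P (\<Phi> zb)"
    have "u0 \<in> U" unfolding u0_def using graph(1) base W(2) by blast
    then obtain r where r: "r > 0" "ball u0 r \<inter> coord_space K \<subseteq> U"
      using U openin_contains_ball by metis
    define m where "m = min (r / 2) (min (\<delta> / 2) (c / 2))"
    have m: "m > 0" "m \<le> r / 2" "m \<le> \<delta> / 2" "m \<le> c / 2"
    proof -
      show "m > 0" using r \<delta> c by (simp add: m_def)
      show "m \<le> r / 2" unfolding m_def by (rule min.cobounded1)
      show "m \<le> \<delta> / 2" unfolding m_def by (rule min.coboundedI2, rule min.cobounded1)
      show "m \<le> c / 2" unfolding m_def by (rule min.coboundedI2, rule min.cobounded2)
    qed
    obtain c' where c': "c' > 0" "\<And>z. dist z zb < c' \<Longrightarrow> dist (\<Phi> z) (\<Phi> zb) < m"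
      using cont[OF m(1)] by blast
    \<comment> \<open>A move by \<open>t\<close> displaces the parameter by \<open>t * norm x\<close>, the point of the graph by at most
        \<open>(1 + L) * (t * norm x)\<close> and the point of the set by at most \<open>C * (t * norm x)\<close>; \<open>t * k\<close> bounds all three.\<close>
    define k where "k = 1 + (1 + L + C) * norm x"
    have k: "k \<ge> 1" using L C by (simp add: k_def)
    show "\<exists>d>0. \<forall>z\<in>\<Omega>. \<forall>t. dist z zb < d \<longrightarrow> 0 < t \<longrightarrow> t < d \<longrightarrow>
            (\<exists>w\<in>\<Omega>. norm (w - z) \<le> 2 * C * norm x * t \<and> norm (B (w - z) - t *\<^sub>R x) \<le> e * t)"
    proof (intro exI[of _ "min (c / 2) (min c' (m / k))"] conjI ballI allI impI)
      show "0 < min (c / 2) (min c' (m / k))" using c c' m k by auto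
      fix z t assume z: "z \<in> \<Omega>" "dist z zb < min (c / 2) (min c' (m / k))"
        and t: "0 < t" "t < min (c / 2) (min c' (m / k))"
      have zc: "dist z zb < c / 2" and \<Phi>z: "dist (\<Phi> z) (\<Phi> zb) < m" using z(2) c'(2) by auto
      have zW: "z \<in> \<Omega> \<inter> W" using z(1) zc c(1,2) by (auto simp: dist_commute)
      have "t * k < m" using t(2) k by (simp add: pos_less_divide_eq)
      moreover have "t * k = t + t * norm x + L * (t * norm x) + C * (t * norm x)"
        by (simp add: k_def algebra_simps)
      moreover have "0 \<le> t * norm x" "0 \<le> L * (t * norm x)" "0 \<le> C * (t * norm x)"
        using t L C by auto
      ultimately have small: "t * norm x < m" "(1 + L) * (t * norm x) < m" "C * (t * norm x) < m"
        using t(1) unfolding distrib_right mult_1 by linarith+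
      define u where "u = ?P (\<Phi> z)"
      have "u \<in> U" unfolding u_def by (rule graph(1)[OF zW])
      have "norm (u - u0) \<le> norm (\<Phi> z - \<Phi> zb)"
        unfolding u_def u0_def linear_diff[OF linP, symmetric] by (rule norm_coord_proj_le)
      then have "norm (u - u0) < m" using \<Phi>z by (simp add: dist_norm)
      moreover have "norm ((u + t *\<^sub>R x) - u0) \<le> norm (u - u0) + norm (t *\<^sub>R x)"
        using norm_triangle_ineq[of "u - u0" "t *\<^sub>R x"] by (simp add: algebra_simps)
      ultimately have "dist u0 (u + t *\<^sub>R x) < r"
        using small(1) m(2) t(1) by (simp add: dist_norm norm_minus_commute)
      moreover have "u + t *\<^sub>R x \<in> coord_space K"
        using \<open>u \<in> U\<close> U_sub x[unfolded rangeB] subspace_coord_space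
        by (intro subspace_add subspace_scale) auto
      ultimately have uU: "u + t *\<^sub>R x \<in> U" using r(2) by auto
      then have "(u + t *\<^sub>R x) + f (u + t *\<^sub>R x) \<in> \<Phi> ` (\<Omega> \<inter> W)" unfolding img by blast
      then obtain w where w: "w \<in> \<Omega> \<inter> W" "\<Phi> w = (u + t *\<^sub>R x) + f (u + t *\<^sub>R x)" by auto
      have Pw: "?P (\<Phi> w) = u + t *\<^sub>R x" unfolding w(2) by (rule Pf[OF uU])
      have "\<Phi> z = u + f u" unfolding u_def by (rule graph(2)[OF zW])
      then have "norm (\<Phi> w - \<Phi> z) \<le> (1 + L) * norm (t *\<^sub>R x)"
        using graph_lip[OF uU \<open>u \<in> U\<close>] unfolding w(2) by simp
      then have "dist (\<Phi> w) (\<Phi> z) < m" using small(2) t(1) by (simp add: dist_norm)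
      then have "dist (\<Phi> w) (\<Phi> zb) < \<delta>" "dist (\<Phi> z) (\<Phi> zb) < \<delta>"
        using \<Phi>z m dist_triangle[of "\<Phi> w" "\<Phi> zb" "\<Phi> z"] by linarith+
      then have "norm (w - z) \<le> C * norm (?P (\<Phi> w - \<Phi> z))"
        using w(1) zW by (intro near_lip) (auto simp: dist_commute)
      also have Pwz: "?P (\<Phi> w - \<Phi> z) = t *\<^sub>R x" using Pw by (simp add: linear_diff[OF linP] u_def)
      finally have wz: "norm (w - z) \<le> C * norm x * t" using t(1) by (simp add: mult_ac)
      then have "norm (w - z) < m" using small(3) by (simp add: mult_ac)
      then have "dist w zb < c"
        using zc m dist_triangle[of w zb z] by (simp add: dist_norm)
      moreover have "dist z zb < c" using zc c(1) by linarith
      ultimately have "norm (\<Phi> w - \<Phi> z - A (w - z)) \<le> h * norm (w - z)"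
        by (intro c(3)) (auto simp: dist_commute)
      also have "\<dots> \<le> h * (C * norm x * t)" using wz h by (intro mult_left_mono) auto
      also have "\<dots> \<le> e * t" using h(2) t(1) by (simp add: mult.assoc[symmetric])
      finally have "norm (B (w - z) - t *\<^sub>R x) \<le> e * t" using B_approx[of w z] unfolding Pwz by linarith
      moreover have "0 \<le> C * norm x * t" using C t(1) by simp
      with wz have "norm (w - z) \<le> 2 * C * norm x * t" by linarith
      ultimately show "\<exists>w\<in>\<Omega>. norm (w - z) \<le> 2 * C * norm x * t \<and> norm (B (w - z) - t *\<^sub>R x) \<le> e * t"
        using w(1) by blast
    qed
  qed
  moreover have "dim (range B) = d" unfolding rangeB dim_coord_space by (rule K)
  ultimately show ?thesis by blast
qed

section \<open>Characterizations of strict smoothness\<close>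

text \<open>The regular normal cone is polar to the tangent cone, which equals the regular tangent cone,
  and the limiting normal cone lies between the regular normal cone and the polar of the regular
  tangent cone.\<close>

lemma strictly_smooth_normal_cones:
  fixes \<Omega> :: "'a::euclidean_space set"
  assumes base: "zb \<in> \<Omega>" and smooth: "strictly_smooth \<Omega> zb"
  shows "regular_normal_cone \<Omega> zb = orthogonal_comp (regular_tangent_cone \<Omega> zb)"
    and "limiting_normal_cone \<Omega> zb = orthogonal_comp (regular_tangent_cone \<Omega> zb)"
proof -
  note * = strictly_smooth_cones[OF base smooth]
  show 1: "regular_normal_cone \<Omega> zb = orthogonal_comp (regular_tangent_cone \<Omega> zb)"
    unfolding regular_normal_cone_def *(2) by (rule polar_cone_subspace[OF *(3)])
  then show "limiting_normal_cone \<Omega> zb = orthogonal_comp (regular_tangent_cone \<Omega> zb)"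
    using regular_normal_subset_limiting_normal_cone[OF base] limiting_normal_subset_polar_regular_tangent_cone[OF base]
      polar_cone_subspace[OF *(3)] by order
qed

theorem theorem3p2:
  fixes \<Omega> :: "(real ^ 'n) set" and zb :: "real ^ 'n"
  assumes "zb \<in> \<Omega>"
    and "locally_closed_at \<Omega> zb"
  shows "(strictly_smooth \<Omega> zb \<longleftrightarrow>
            (\<exists>d. lipschitz_manifold_dim d \<Omega> zb \<and>
                 subspace (regular_tangent_cone \<Omega> zb) \<and> dim (regular_tangent_cone \<Omega> zb) = d)) \<and>
         (strictly_smooth \<Omega> zb \<longleftrightarrow>
            lipschitz_manifold \<Omega> zb \<and> subspace (paratingent_cone \<Omega> zb)) \<and>
         (strictly_smooth \<Omega> zb \<longleftrightarrow>
            lipschitz_manifold \<Omega> zb \<and> subspace (limiting_normal_cone \<Omega> zb)) \<and>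
         (strictly_smooth \<Omega> zb \<longleftrightarrow>
            lipschitz_manifold \<Omega> zb \<and> normally_regular \<Omega> zb) \<and>
         (strictly_smooth \<Omega> zb \<longrightarrow>
            (\<forall>d. lipschitz_manifold_dim d \<Omega> zb \<longrightarrow>
                 dim (paratingent_cone \<Omega> zb) = d \<and>
                 dim (tangent_cone \<Omega> zb) = d \<and>
                 dim (regular_tangent_cone \<Omega> zb) = d \<and>
                 dim (limiting_normal_cone \<Omega> zb) = CARD('n) - d))"
proof -
  note base = assms(1) and clo = assms(2)
  have chart: "\<exists>(B :: real ^ 'n \<Rightarrow> real ^ 'n) C. linear_chart \<Omega> zb B C"
    if "lipschitz_manifold \<Omega> zb"
    using that lipschitz_manifold_imp_linear_chart[OF _ base] unfolding lipschitz_manifold_def by blast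
  have ii: "strictly_smooth \<Omega> zb"
    if ii: "lipschitz_manifold_dim d \<Omega> zb" "subspace (regular_tangent_cone \<Omega> zb)"
      "dim (regular_tangent_cone \<Omega> zb) = d" for d
  proof -
    obtain B :: "real ^ 'n \<Rightarrow> real ^ 'n" and C where "linear_chart \<Omega> zb B C" "dim (range B) = d"
      using lipschitz_manifold_imp_linear_chart[OF ii(1) base] by blast
    then show ?thesis using ii(2,3) linear_chart.strictly_smooth_if_regular_tangent_dim by fastforce
  qed
  have iii: "strictly_smooth \<Omega> zb" if "lipschitz_manifold \<Omega> zb" "subspace (paratingent_cone \<Omega> zb)"
    using chart[OF that(1)] linear_chart.strictly_smooth_if_paratingent_subspace that(2) by blast
  have iv: "strictly_smooth \<Omega> zb" if "lipschitz_manifold \<Omega> zb" "subspace (limiting_normal_cone \<Omega> zb)"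
    using chart[OF that(1)] linear_chart.strictly_smooth_if_limiting_normal_subspace that(2) clo by blast
  have v: "strictly_smooth \<Omega> zb" if "lipschitz_manifold \<Omega> zb" "normally_regular \<Omega> zb"
    using chart[OF that(1)] linear_chart.strictly_smooth_if_normally_regular that(2) clo by blast
  show ?thesis
  proof (cases "strictly_smooth \<Omega> zb")
    case False
    then show ?thesis using ii iii iv v by blast
  next
    case smooth: True
    note cones = strictly_smooth_cones[OF base smooth]
    note normals = strictly_smooth_normal_cones[OF base smooth]
    have man: "lipschitz_manifold_dim (dim (regular_tangent_cone \<Omega> zb)) \<Omega> zb"
      by (rule strictly_smooth_imp_lipschitz_manifold_dim[OF base clo smooth])
    then have "lipschitz_manifold \<Omega> zb" by (auto simp: lipschitz_manifold_def)
    moreover have "subspace (paratingent_cone \<Omega> zb)" "subspace (limiting_normal_cone \<Omega> zb)"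
      using cones normals by (simp_all add: subspace_orthogonal_comp)
    moreover have "normally_regular \<Omega> zb" using normals by (simp add: normally_regular_def)
    moreover have "dim (paratingent_cone \<Omega> zb) = d \<and> dim (tangent_cone \<Omega> zb) = d \<and>
        dim (regular_tangent_cone \<Omega> zb) = d \<and> dim (limiting_normal_cone \<Omega> zb) = CARD('n) - d"
      if d: "lipschitz_manifold_dim d \<Omega> zb" for d
    proof -
      obtain B :: "real ^ 'n \<Rightarrow> real ^ 'n" and C where "linear_chart \<Omega> zb B C" "dim (range B) = d"
        using lipschitz_manifold_imp_linear_chart[OF d base] by blast
      then have "dim (regular_tangent_cone \<Omega> zb) = d"
        using linear_chart.strictly_smooth_dim smooth by fastforce
      moreover have "dim (limiting_normal_cone \<Omega> zb) = CARD('n) - dim (regular_tangent_cone \<Omega> zb)"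
        unfolding normals(2) by (simp add: dim_orthogonal_comp[OF cones(3)])
      ultimately show ?thesis unfolding cones(1,2) by simp
    qed
    ultimately show ?thesis using smooth man cones(3) by blast
  qed
qed

end
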